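(* Assume that $f$, $h$ and $\alpha$ satisfy (A1)–(A2) and (B1)–(B7) (see context), and let $T>0$, $L>0$, $x_0\ge 0$. Then either Problem P (see context) has no solution, or every solution has the following structure: with the possible exceptions of one initial and one final acceleration/deceleration phase, the speed $x$ of the vehicle oscillates between two values without intermediate local extrema. That is, if $u:[0,T]\to\{0,1\}$ is a solution of Problem P with associated trajectory $x:[0,T]\to\mathbf{R}$, then the local extrema of the restriction of $x$ to the open interval $(0,T)$ take at most two distinct values.
   Context: Dynamics. $f:\mathbf{R}\times\{0,1\}\to\mathbf{R}$ and $\dot x=f(x,u)$, where $x$ is the real-valued speed and $u$ is a piecewise constant control (finitely many discontinuities) with values in $\{0,1\}$ ($0$: engine off, $1$: engine on). For a piecewise constant $u$, a solution $x$ is a continuous, piecewise differentiable function satisfying $\dot x(t)=f(x(t),u(t))$ for almost every $t$. Cost. $h:\mathbf{R}\times\{0,1\}\to[0,+\infty)$ is $C^1$ in its first variable, $\alpha>0$ is a real constant, and $$C(u)=\int_0^T h(x(t),u(t))\,dt+\alpha N(u),$$ where $N(u)$ is the number of times $u$ jumps from $0$ to $1$. Problem P. Find a piecewise constant control $u:[0,T]\to\{0,1\}$ such that the associated solution $x$ of $\dot x=f(x,u)$ with $x(0)=x_0$ satisfies $\int_0^T x(t)\,dt=L$, and which minimizes $C$ among all such controls. Assumptions. (A1) For each $u\in\{0,1\}$, $x\mapsto f(x,u)$ is continuous. (A2) For every $x_0\in\mathbf{R}$ and each constant $u\in\{0,1\}$, the Cauchy problem $\dot x=f(x,u)$, $x(0)=x_0$,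 has a unique solution in positive time. (Backward uniqueness is not assumed.) (B1) There is $V^\ast>0$ such that $f(x,1)>0$ if $x<V^\ast$, $f(V^\ast,1)=0$, and $f(x,1)<0$ if $x>V^\ast$. (B2) $f(x,0)<f(x,1)$ for every $x$. (B3) There is $V_\ast\in\mathbf{R}$ (possibly negative) such that $f(x,0)<0$ if $x>V_\ast$, $f(x,0)>0$ if $x<V_\ast$, and $f(V_\ast,0)=0$. (B4) $h(x,1)>h(x,0)=0$ for every $x$. (B5) $x\mapsto h(x,1)$ is non-decreasing. (B6) All the following integrals converge and $$\int_{V_\ast}^{V^\ast}\frac{h(V^\ast,1)-h(s,1)}{f(s,1)}ds+\alpha<\frac{h(V^\ast,1)}{V^\ast-V_\ast}\left(\int_{V^\ast}^{V_\ast}\frac{s-V_\ast}{f(s,0)}ds+\int_{V_\ast}^{V^\ast}\frac{s-V^\ast}{f(s,1)}ds\right).$$ (B7) The function $F:x\mapsto \dfrac{h(x,1)f(x,0)}{f(x,1)-f(x,0)}$ is either strictly concave or strictly convex. Local extrema are understood in the weak sense (so they include points of intervals where $x$ is constant); the monotone portions of $x$ before its first and after its last local extremum in $(0,T)$ are the initial and final acceleration/deceleration phases. *)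

theory Defs
  imports "HOL-Analysis.Analysis"
begin

text \<open>
  The control set $\{0,1\}$ is the type \<^typ>\<open>bool\<close>: \<^term>\<open>False\<close> is $0$ (engine off) and
  \<^term>\<open>True\<close> is $1$ (engine on). Controls and trajectories are total functions on the reals,
  but all the notions below only look at their values on the time interval under consideration.
\<close>

definition piecewise_constant :: "real \<Rightarrow> (real \<Rightarrow> bool) \<Rightarrow> bool" where
  "piecewise_constant T u \<longleftrightarrow>
     (\<exists>S. finite S \<and>
        (\<forall>a b. 0 \<le> a \<longrightarrow> a < b \<longrightarrow> b \<le> T \<longrightarrow> {a<..<b} \<inter> S = {} \<longrightarrow> u constant_on {a<..<b}))"

text \<open>Continuity of \<^term>\<open>x\<close> is part of \<^const>\<open>piecewise_differentiable_on\<close>.\<close>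

definition solves_on ::
  "(real \<Rightarrow> bool \<Rightarrow> real) \<Rightarrow> (real \<Rightarrow> bool) \<Rightarrow> (real \<Rightarrow> real) \<Rightarrow> real set \<Rightarrow> bool" where
  "solves_on f u x I \<longleftrightarrow>
     x piecewise_differentiable_on I \<and>
     (AE t in lborel. t \<in> I \<longrightarrow> (x has_real_derivative f (x t) (u t)) (at t within I))"

text \<open>
  Existence is on the whole half-line; uniqueness is among all solutions on all intervals
  \<^term>\<open>{0..\<tau>}\<close>. Nothing is required in backward time.
\<close>

definition unique_forward_solution :: "(real \<Rightarrow> bool \<Rightarrow> real) \<Rightarrow> bool \<Rightarrow> real \<Rightarrow> bool" where
  "unique_forward_solution f c x0 \<longleftrightarrow>
     (\<exists>x. solves_on f (\<lambda>_. c) x {0..} \<and> x 0 = x0) \<and>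
     (\<forall>\<tau>>0. \<forall>x y. solves_on f (\<lambda>_. c) x {0..\<tau>} \<longrightarrow> x 0 = x0 \<longrightarrow>
                 solves_on f (\<lambda>_. c) y {0..\<tau>} \<longrightarrow> y 0 = x0 \<longrightarrow>
                 (\<forall>t\<in>{0..\<tau>}. x t = y t))"

text \<open>
  A jump from $0$ to $1$ is detected by the one-sided limits of the control, so that values
  at isolated instants, which do not influence the dynamics, are not counted.
\<close>

definition switch_ons :: "real \<Rightarrow> (real \<Rightarrow> bool) \<Rightarrow> nat" where
  "switch_ons T u =
     card {t \<in> {0<..<T}. (\<forall>\<^sub>F s in at_left t. \<not> u s) \<and> (\<forall>\<^sub>F s in at_right t. u s)}"

definition cost ::
  "(real \<Rightarrow> bool \<Rightarrow> real) \<Rightarrow> real \<Rightarrow> real \<Rightarrow> (real \<Rightarrow> bool) \<Rightarrow> (real \<Rightarrow> real) \<Rightarrow> real" where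
  "cost h \<alpha> T u x = integral {0..T} (\<lambda>t. h (x t) (u t)) + \<alpha> * real (switch_ons T u)"

definition admissible ::
  "(real \<Rightarrow> bool \<Rightarrow> real) \<Rightarrow> real \<Rightarrow> real \<Rightarrow> real \<Rightarrow> (real \<Rightarrow> bool) \<Rightarrow> (real \<Rightarrow> real) \<Rightarrow> bool" where
  "admissible f T L x0 u x \<longleftrightarrow>
     piecewise_constant T u \<and> solves_on f u x {0..T} \<and> x 0 = x0 \<and> integral {0..T} x = L"

definition solves_problem_P ::
  "(real \<Rightarrow> bool \<Rightarrow> real) \<Rightarrow> (real \<Rightarrow> bool \<Rightarrow> real) \<Rightarrow> real \<Rightarrow> real \<Rightarrow> real \<Rightarrow> real \<Rightarrow>
   (real \<Rightarrow> bool) \<Rightarrow> (real \<Rightarrow> real) \<Rightarrow> bool" where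
  "solves_problem_P f h \<alpha> T L x0 u x \<longleftrightarrow>
     admissible f T L x0 u x \<and>
     (\<forall>v y. admissible f T L x0 v y \<longrightarrow> cost h \<alpha> T u x \<le> cost h \<alpha> T v y)"

definition strictly_convex_on :: "real set \<Rightarrow> (real \<Rightarrow> real) \<Rightarrow> bool" where
  "strictly_convex_on S F \<longleftrightarrow>
     convex S \<and>
     (\<forall>x\<in>S. \<forall>y\<in>S. \<forall>\<theta>. x \<noteq> y \<longrightarrow> 0 < \<theta> \<longrightarrow> \<theta> < 1 \<longrightarrow>
        F ((1 - \<theta>) * x + \<theta> * y) < (1 - \<theta>) * F x + \<theta> * F y)"

definition strictly_concave_on :: "real set \<Rightarrow> (real \<Rightarrow> real) \<Rightarrow> bool" where
  "strictly_concave_on S F \<longleftrightarrow> strictly_convex_on S (\<lambda>x. - F x)"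

definition weak_local_extremum_on :: "real set \<Rightarrow> (real \<Rightarrow> real) \<Rightarrow> real \<Rightarrow> bool" where
  "weak_local_extremum_on S g t \<longleftrightarrow>
     t \<in> S \<and>
     ((\<forall>\<^sub>F s in at t within S. g s \<le> g t) \<or> (\<forall>\<^sub>F s in at t within S. g t \<le> g s))"

end

theory Submission
  imports Defs
begin

text \<open>
  Let $F$ be the function of (B7). Moving the level of a local extremum $c$ of an optimal trajectory
  so that the total time changes by $w$ changes the distance by $c w + o(w)$ and the cost by
  $-F(c) w + o(w)$, without additional starts of the engine. The same holds when $c$ is an equilibrium
  speed and a phase of constant speed $c$ is lengthened or shortened. If three extremal
  values $c_0, c_1, c_2$ were distinct, then time and distance could be kept fixed while varying the
  three levels, and minimality of the cost would force the points $(c_i, F(c_i))$ to be collinear, which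
  contradicts the strict concavity or convexity of $F$.
\<close>

section \<open>Arcs and trajectories\<close>

text \<open>The rate -F(c) comes from splitting a gained time w between the modes k and l meeting at
  the extremum in the proportion \<gamma> : 1 - \<gamma> that leaves no net drift of the speed,
  \<gamma> f(c,k) + (1 - \<gamma>) f(c,l) = 0. The running cost then grows at the rate \<gamma>
  h(c,k) + (1 - \<gamma>) h(c,l), the cost of holding speed c by infinitely fast switching. The
  obstacle is regularity: f is only continuous and backward uniqueness may fail, so there is no flow
  to differentiate. The two arcs are instead prolonged past the extremum and joined at a shifted
  level. Through a speed that is no equilibrium a prolongation exists in both time directions by
  separation of variables; an equilibrium may be reached in finite time, and there the prolongation
  is constant. The changes of distance and cost are shown to be differentiable at w = 0 only, so the
  intermediate value theorem stands in for the implicit function theorem. Three levels are the least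
  possible: time and distance are two constraints, and one degree of freedom must remain.\<close>

text \<open>Differentiability off a finite set makes the fundamental theorem of calculus applicable
  to \<open>deriv x\<close>. Since \<open>deriv x\<close> agrees almost everywhere with the
  continuous \<open>g\<close>, \<open>x\<close> is a primitive of \<open>g\<close>, hence
  differentiable everywhere, one-sidedly at the endpoints.\<close>

lemma has_real_derivative_of_AE:
  fixes x g :: "real \<Rightarrow> real"
  assumes contx: "continuous_on {a..b} x" and contg: "continuous_on {a..b} g"
    and S: "finite S" and diff: "\<And>t. t \<in> {a<..<b} - S \<Longrightarrow> x differentiable (at t)"
    and ae: "AE t in lborel. t \<in> {a<..<b} \<longrightarrow> (x has_real_derivative g t) (at t)"
    and t: "t \<in> {a..b}"
  shows "(x has_real_derivative g t) (at t within {a..b})"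
proof -
  define N where "N = {t \<in> {a<..<b}. \<not> (x has_real_derivative g t) (at t)}"
  obtain N' where N': "N' \<in> null_sets lborel" "{t \<in> space lborel. \<not> (t \<in> {a<..<b} \<longrightarrow> (x has_real_derivative g t) (at t))} \<subseteq> N'"
    using ae unfolding eventually_ae_filter by auto
  have "N \<in> null_sets lebesgue"
    by (rule null_sets_completion_subset[of _ N']) (use N' in \<open>auto simp: N_def intro: null_sets_completionI\<close>)
  then have neg: "negligible (N \<union> {a, b})"
    by (simp add: negligible_iff_null_sets[symmetric] negligible_Un)
  have eq: "x s = x a + integral {a..s} g" if s: "s \<in> {a..b}" for s
  proof -
    have "(deriv x has_integral (x s - x a)) {a..s}"
    proof (rule fundamental_theorem_of_calculus_interior_strong[OF S])
      show "a \<le> s" "continuous_on {a..s} x"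
        using s by (auto intro: continuous_on_subset[OF contx])
      show "(x has_vector_derivative deriv x r) (at r)" if "r \<in> {a<..<s} - S" for r
        using diff[of r] that s
        by (auto simp: has_real_derivative_iff_has_vector_derivative[symmetric] DERIV_deriv_iff_real_differentiable)
    qed
    then have "(g has_integral (x s - x a)) {a..s}"
    proof (rule has_integral_spike[OF neg, rotated])
      show "g r = deriv x r" if "r \<in> {a..s} - (N \<union> {a, b})" for r
        using that s by (auto simp: N_def dest: DERIV_imp_deriv)
    qed
    then show ?thesis by (simp add: integral_unique)
  qed
  have "((\<lambda>s. x a + integral {a..s} g) has_real_derivative g t) (at t within {a..b})"
    using integral_has_real_derivative[OF contg t] by (auto intro!: derivative_eq_intros)
  then show ?thesis
    by (rule has_field_derivative_transform_within[OF _ zero_less_one t]) (rule eq[symmetric])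
qed

lemma constant_on_if_locally_constant:
  fixes u :: "real \<Rightarrow> 'a"
  assumes "\<And>t. t \<in> {a<..<b} \<Longrightarrow> \<forall>\<^sub>F s in nhds t. u s = u t"
  shows "u constant_on {a<..<b}"
proof (rule locally_constant_imp_constant)
  show "connected {a<..<b}" by simp
  fix c assume c: "c \<in> {a<..<b}"
  then obtain U where "open U" "c \<in> U" "\<forall>s\<in>U. u s = u c"
    using assms unfolding eventually_nhds by blast
  then show "\<exists>V. openin (top_of_set {a<..<b}) V \<and> c \<in> V \<and> (\<forall>x\<in>V. u x = u c)"
    using c by (intro exI[of _ "{a<..<b} \<inter> U"]) (blast intro: openin_open_Int)
qed

locale control_system =
  fixes f h :: "real \<Rightarrow> bool \<Rightarrow> real"
  assumes cont_f: "\<And>k. continuous_on UNIV (\<lambda>x. f x k)"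
    and cont_h: "\<And>k. continuous_on UNIV (\<lambda>x. h x k)"
begin

text \<open>The one-sided derivatives at the endpoints are included: they carry the sign information
  at an extremum and allow two arcs of the same mode to be joined.\<close>

definition arc :: "bool \<Rightarrow> (real \<Rightarrow> real) \<Rightarrow> real set \<Rightarrow> bool" where
  "arc k y I \<longleftrightarrow> (\<forall>t\<in>I. (y has_real_derivative f (y t) k) (at t within I))"

text \<open>Pointwise counterpart of a piecewise constant control with its solution: a finite
  exceptional set replaces the null set, and the control is locally constant off it. Both conditions
  are local, which makes gluing easy to check.\<close>

definition trajectory :: "real \<Rightarrow> (real \<Rightarrow> bool) \<Rightarrow> (real \<Rightarrow> real) \<Rightarrow> bool" where
  "trajectory T u x \<longleftrightarrow> continuous_on {0..T} x \<and>
     (\<exists>S. finite S \<and> (\<forall>t\<in>{0<..<T} - S.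
        (x has_real_derivative f (x t) (u t)) (at t) \<and> (\<forall>\<^sub>F s in nhds t. u s = u t)))"

lemma continuous_on_f [continuous_intros]:
  "continuous_on I y \<Longrightarrow> continuous_on I (\<lambda>t. f (y t) k)"
  using continuous_on_compose2[OF cont_f] by auto

lemma arc_continuous_on: "arc k y I \<Longrightarrow> continuous_on I y"
  unfolding arc_def by (intro DERIV_continuous_on) auto

lemma arc_subset: "arc k y I \<Longrightarrow> J \<subseteq> I \<Longrightarrow> arc k y J"
  unfolding arc_def by (meson DERIV_subset subsetD)

lemma arc_AE:
  assumes "continuous_on {a..b} y"
    and "finite S" "\<And>t. t \<in> {a<..<b} - S \<Longrightarrow> y differentiable (at t)"
    and "AE t in lborel. t \<in> {a<..<b} \<longrightarrow> (y has_real_derivative f (y t) k) (at t)"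
  shows "arc k y {a..b}"
  unfolding arc_def
  using has_real_derivative_of_AE[where g="\<lambda>t. f (y t) k", OF assms(1) continuous_on_f[OF assms(1)] assms(2-4)]
  by blast

lemma arcI_interior:
  assumes "continuous_on {a..b} y" and S: "finite S"
    and der: "\<And>t. t \<in> {a<..<b} - S \<Longrightarrow> (y has_real_derivative f (y t) k) (at t)"
  shows "arc k y {a..b}"
proof (rule arc_AE[OF assms(1,2)])
  show "y differentiable (at t)" if "t \<in> {a<..<b} - S" for t
    using der[OF that] real_differentiable_def by blast
  have "AE t in lborel. t \<notin> S"
    using S by (intro AE_not_in finite_imp_null_set_lborel)
  then show "AE t in lborel. t \<in> {a<..<b} \<longrightarrow> (y has_real_derivative f (y t) k) (at t)"
    by eventually_elim (use der in auto)
qed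

lemma arc_interiorD:
  assumes "arc k y {a..b}" "t \<in> {a<..<b}"
  shows "(y has_real_derivative f (y t) k) (at t)"
  using assms unfolding arc_def
  by (metis at_within_Icc_at atLeastAtMost_iff greaterThanLessThan_iff less_imp_le)

text \<open>At \<open>m\<close> the left and the right difference quotients have the same limit
  \<open>f (y m) k\<close>, because both pieces run in the same mode and agree there.\<close>

lemma arc_join:
  assumes "arc k y {a..m}" "arc k z {m..b}" "y m = z m" "a \<le> m" "m \<le> b"
  shows "arc k (\<lambda>t. if t \<le> m then y t else z t) {a..b}"
  unfolding arc_def
proof
  fix t assume t: "t \<in> {a..b}"
  let ?x = "\<lambda>t. if t \<le> m then y t else z t"
  have ab: "{a..b} = {a..m} \<union> {m..b}" using assms by auto
  have l: "(?x has_real_derivative f (?x t) k) (at t within {a..m})"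
  proof (cases "t \<le> m")
    case True
    then have "(y has_real_derivative f (y t) k) (at t within {a..m})"
      using assms t unfolding arc_def by auto
    then show ?thesis
      by (rule has_field_derivative_transform_within[where d=1, THEN DERIV_cong]) (use True t in auto)
  next
    case False
    \<comment> \<open>Away from the closed piece the filter is trivial, so the limit statement holds
      vacuously.\<close>
    then have "at t within {a..m} = bot"
      by (auto simp: at_within_eq_bot_iff closure_def islimpt_Icc)
        (metis atLeastAtMost_iff closed_atLeastAtMost closed_limpt)
    then show ?thesis by (simp add: has_field_derivative_iff)
  qed
  have r: "(?x has_real_derivative f (?x t) k) (at t within {m..b})"
  proof (cases "m \<le> t")
    case True
    then have "(z has_real_derivative f (z t) k) (at t within {m..b})"
      using assms t unfolding arc_def by auto
    moreover have "?x s = z s" if "s \<in> {m..b}" for s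
      using that assms(3) by auto
    ultimately show ?thesis
      using True t assms(3) by (intro has_field_derivative_transform_within[where d=1 and f=z and g="?x"]) auto
  next
    case False
    then have "at t within {m..b} = bot"
      by (auto simp: at_within_eq_bot_iff)
    then show ?thesis by (simp add: has_field_derivative_iff)
  qed
  show "(?x has_real_derivative f (?x t) k) (at t within {a..b})"
    using l r unfolding ab has_field_derivative_iff by (auto intro: Lim_Un)
qed

lemma arc_shift:
  assumes "arc k y {a..b}"
  shows "arc k (\<lambda>t. y (t - c)) {a + c..b + c}"
proof (rule arcI_interior[of _ _ _ "{}"])
  show "continuous_on {a + c..b + c} (\<lambda>t. y (t - c))"
    by (rule continuous_on_compose2[OF arc_continuous_on[OF assms]]) (auto intro!: continuous_intros)
  show "((\<lambda>t. y (t - c)) has_real_derivative f (y (t - c)) k) (at t)" if "t \<in> {a + c<..<b + c} - {}" for t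
    using arc_interiorD[OF assms, of "t - c"] DERIV_shift[of y _ t "-c"] that by auto
qed simp

lemma trajectory_arc:
  assumes tr: "trajectory T u x" and ab: "0 \<le> a" "b \<le> T"
    and u: "\<And>t. t \<in> {a<..<b} \<Longrightarrow> u t = k"
  shows "arc k x {a..b}"
proof -
  obtain S where S: "finite S" "\<And>t. t \<in> {0<..<T} - S \<Longrightarrow> (x has_real_derivative f (x t) (u t)) (at t)"
    using tr unfolding trajectory_def by blast
  have cont: "continuous_on {0..T} x" using tr unfolding trajectory_def by blast
  show ?thesis
  proof (rule arcI_interior[OF _ S(1)])
    show "continuous_on {a..b} x" by (rule continuous_on_subset[OF cont]) (use ab in auto)
    show "(x has_real_derivative f (x t) k) (at t)" if "t \<in> {a<..<b} - S" for t
      using S(2)[of t] u[of t] that ab by auto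
  qed
qed

text \<open>An extremum may lie on a switching time, so the modes \<open>k\<close> and
  \<open>l\<close> before and after it are kept apart. The radius \<open>r\<close> later makes
  windows around different extrema disjoint.\<close>

lemma trajectory_one_sided_arcs:
  assumes tr: "trajectory T u x" and t: "0 < t" "t < T" and r: "0 < r"
  obtains p q k l where "t - r < p" "0 < p" "p < t" "t < q" "q < t + r" "q < T"
    "\<And>s. s \<in> {p<..<t} \<Longrightarrow> u s = k" "\<And>s. s \<in> {t<..<q} \<Longrightarrow> u s = l"
    "arc k x {p..t}" "arc l x {t..q}"
proof -
  obtain S where S: "finite S" "\<And>t. t \<in> {0<..<T} - S \<Longrightarrow> (\<forall>\<^sub>F s in nhds t. u s = u t)"
    using tr unfolding trajectory_def by blast
  have const: "u constant_on {a<..<b}" if "{a<..<b} \<subseteq> {0<..<T} - S" for a b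
    by (rule constant_on_if_locally_constant) (use S(2) that in blast)
  obtain e where e: "e > 0" "\<And>s. s \<in> S \<Longrightarrow> s \<noteq> t \<Longrightarrow> e \<le> \<bar>s - t\<bar>"
    using finite_set_avoid[OF S(1), of t] by (auto simp: dist_real_def abs_minus_commute)
  define d where "d = min (min e r) (min t (T - t)) / 2"
  have d: "d > 0" "d < e" "d < r" "d < t" "d < T - t" using e(1) r t by (auto simp: d_def min_def)
  have "s \<in> {0<..<T} - S" if "s \<noteq> t" "t - d < s" "s < t + d" for s
    using e(2)[of s] that d t by (auto simp: abs_if split: if_splits)
  then have "{t - d<..<t} \<subseteq> {0<..<T} - S" "{t<..<t + d} \<subseteq> {0<..<T} - S"
    by auto
  then obtain k l where kl: "\<And>s. s \<in> {t - d<..<t} \<Longrightarrow> u s = k" "\<And>s. s \<in> {t<..<t + d} \<Longrightarrow> u s = l"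
    using const unfolding constant_on_def by metis
  have arcs: "arc k x {t - d..t}" "arc l x {t..t + d}"
    by (rule trajectory_arc[OF tr]; use kl d t in simp)+
  show thesis
    by (rule that[OF _ _ _ _ _ _ kl arcs]) (use d t in simp_all)
qed

section \<open>Trajectories and admissible pairs\<close>

text \<open>Near a time outside both exceptional sets the control is constant, so the equation has a
  continuous right-hand side there and \<open>arc_AE\<close> turns its almost-everywhere form into a
  pointwise one. Points of \<open>S2\<close> inside the small window are absorbed by
  \<open>arc_AE\<close>.\<close>

lemma trajectory_if_solves_on:
  assumes pc: "piecewise_constant T u" and sol: "solves_on f u x {0..T}"
  shows "trajectory T u x"
proof -
  have cont: "continuous_on {0..T} x"
    using sol unfolding solves_on_def piecewise_differentiable_on_def by blast
  obtain S1 where S1: "finite S1"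
    "\<And>a b. 0 \<le> a \<Longrightarrow> a < b \<Longrightarrow> b \<le> T \<Longrightarrow> {a<..<b} \<inter> S1 = {} \<Longrightarrow> u constant_on {a<..<b}"
    using pc unfolding piecewise_constant_def by metis
  obtain S2 where S2: "finite S2" "\<And>t. t \<in> {0..T} - S2 \<Longrightarrow> x differentiable (at t within {0..T})"
    using sol unfolding solves_on_def piecewise_differentiable_on_def by blast
  have ae: "AE t in lborel. t \<in> {0..T} \<longrightarrow> (x has_real_derivative f (x t) (u t)) (at t within {0..T})"
    using sol unfolding solves_on_def by blast
  have "(x has_real_derivative f (x t) (u t)) (at t) \<and> (\<forall>\<^sub>F s in nhds t. u s = u t)"
    if t: "t \<in> {0<..<T} - (S1 \<union> S2)" for t
  proof -
    obtain e where e: "e > 0" "\<And>s. s \<in> S1 \<Longrightarrow> s \<noteq> t \<Longrightarrow> e \<le> \<bar>s - t\<bar>"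
      using finite_set_avoid[OF S1(1), of t] by (auto simp: dist_real_def abs_minus_commute)
    define d where "d = min e (min t (T - t)) / 2"
    have d: "d > 0" "d < e" "d < t" "d < T - t" using e(1) t by (auto simp: d_def min_def)
    have disj: "{t - d<..<t + d} \<inter> S1 = {}"
    proof -
      have "s \<notin> S1" if "s \<in> {t - d<..<t + d}" for s
        using e(2)[of s] that d t by (cases "s = t") (auto simp: abs_if split: if_splits)
      then show ?thesis by blast
    qed
    then have "u constant_on {t - d<..<t + d}"
      using S1(2)[of "t - d" "t + d"] d t by auto
    moreover have tin: "t \<in> {t - d<..<t + d}" using d by auto
    ultimately have u: "u s = u t" if "s \<in> {t - d<..<t + d}" for s
      using that unfolding constant_on_def by metis
    have within: "at s within {0..T} = at s" if "s \<in> {t - d<..<t + d}" for s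
      using that d by (intro at_within_Icc_at) auto
    have "arc (u t) x {t - d..t + d}"
    proof (rule arc_AE[OF _ S2(1)])
      show "continuous_on {t - d..t + d} x"
        by (rule continuous_on_subset[OF cont]) (use d in auto)
      show "x differentiable (at s)" if "s \<in> {t - d<..<t + d} - S2" for s
        using S2(2)[of s] within[of s] that d by auto
      show "AE s in lborel. s \<in> {t - d<..<t + d} \<longrightarrow> (x has_real_derivative f (x s) (u t)) (at s)"
        using ae
      proof eventually_elim
        case (elim s)
        then show ?case using within[of s] u[of s] d by auto
      qed
    qed
    then have "(x has_real_derivative f (x t) (u t)) (at t)"
      using arc_interiorD tin by blast
    moreover have "\<forall>\<^sub>F s in nhds t. u s = u t"
      unfolding eventually_nhds using u tin open_greaterThanLessThan by blast
    ultimately show ?thesis ..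
  qed
  then show ?thesis
    unfolding trajectory_def using cont S1(1) S2(1) by (intro conjI exI[of _ "S1 \<union> S2"]) auto
qed

lemma trajectory_piecewise_constant:
  assumes "trajectory T u x"
  shows "piecewise_constant T u"
proof -
  obtain S where S: "finite S" "\<And>t. t \<in> {0<..<T} - S \<Longrightarrow> (\<forall>\<^sub>F s in nhds t. u s = u t)"
    using assms unfolding trajectory_def by blast
  have "u constant_on {a<..<b}" if "0 \<le> a" "b \<le> T" "{a<..<b} \<inter> S = {}" for a b
    using that by (intro constant_on_if_locally_constant S(2)) auto
  with S(1) show ?thesis unfolding piecewise_constant_def by metis
qed

lemma trajectory_solves_on:
  assumes "trajectory T u x"
  shows "solves_on f u x {0..T}"
proof -
  obtain S where cont: "continuous_on {0..T} x" and S: "finite S"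
    "\<And>t. t \<in> {0<..<T} - S \<Longrightarrow> (x has_real_derivative f (x t) (u t)) (at t)"
    using assms unfolding trajectory_def by blast
  have der: "(x has_real_derivative f (x t) (u t)) (at t within {0..T})" if "t \<in> {0..T} - (S \<union> {0, T})" for t
    using S(2)[of t] that by (auto intro: has_field_derivative_at_within)
  have "x differentiable (at t within {0..T})" if "t \<in> {0..T} - (S \<union> {0, T})" for t
    using der[OF that] real_differentiable_def by blast
  then have "x piecewise_differentiable_on {0..T}"
    unfolding piecewise_differentiable_on_def
    using cont S(1) by (intro conjI exI[of _ "S \<union> {0, T}"]) auto
  moreover have "AE t in lborel. t \<notin> S \<union> {0, T}"
    using S(1) by (intro AE_not_in finite_imp_null_set_lborel) auto
  then have "AE t in lborel. t \<in> {0..T} \<longrightarrow> (x has_real_derivative f (x t) (u t)) (at t within {0..T})"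
    by eventually_elim (use der in blast)
  ultimately show ?thesis unfolding solves_on_def ..
qed

lemma admissible_iff_trajectory:
  "admissible f T L x0 u x \<longleftrightarrow> trajectory T u x \<and> x 0 = x0 \<and> integral {0..T} x = L"
  unfolding admissible_def
  using trajectory_if_solves_on trajectory_piecewise_constant trajectory_solves_on by blast

lemma trajectory_integrable:
  fixes g :: "real \<Rightarrow> bool \<Rightarrow> real"
  assumes tr: "trajectory T u x" and g: "\<And>k. continuous_on UNIV (\<lambda>y. g y k)"
  shows "(\<lambda>t. g (x t) (u t)) integrable_on {0..T}"
proof -
  obtain S where cont: "continuous_on {0..T} x" and S: "finite S"
    "\<And>t. t \<in> {0<..<T} - S \<Longrightarrow> (\<forall>\<^sub>F s in nhds t. u s = u t)"
    using tr unfolding trajectory_def by blast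
  \<comment> \<open>Up to finitely many times, \<open>U True\<close> and \<open>U False\<close> are
    where the engine is on or off. They are open because the control is locally constant, hence
    measurable, and the integrand is a sum of continuous functions cut off to them.\<close>
  define U where "U k = {t \<in> {0<..<T} - S. u t = k}" for k
  have "open (U k)" for k
  proof (subst open_subopen, rule ballI)
    fix t assume t: "t \<in> U k"
    then have tk: "u t = k" "t \<in> {0<..<T} - S" by (auto simp: U_def)
    then obtain V where V: "open V" "t \<in> V" "\<forall>s\<in>V. u s = k"
      using S(2)[OF tk(2)] unfolding eventually_nhds tk(1) by blast
    have "open (V \<inter> ({0<..<T} - S))"
      using V(1) S(1) by (intro open_Int open_Diff finite_imp_closed) auto
    with V t show "\<exists>W. open W \<and> t \<in> W \<and> W \<subseteq> U k"
      by (intro exI[of _ "V \<inter> ({0<..<T} - S)"]) (auto simp: U_def)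
  qed
  then have meas: "U k \<in> sets lebesgue" for k by auto
  have U_sub: "U k \<subseteq> {0..T}" for k by (auto simp: U_def)
  have int: "(\<lambda>t. if t \<in> U k then g (x t) k else 0) integrable_on {0..T}" for k
  proof -
    have "continuous_on {0..T} (\<lambda>t. g (x t) k)"
      using continuous_on_compose2[OF g cont] by auto
    then have "(\<lambda>t. g (x t) k) absolutely_integrable_on {0..T}"
      by (rule absolutely_integrable_continuous_real)
    then have "(\<lambda>t. g (x t) k) absolutely_integrable_on U k"
      using set_integrable_subset meas U_sub by blast
    then have "(\<lambda>t. g (x t) k) integrable_on U k"
      using set_lebesgue_integral_eq_integral(1) by blast
    moreover have "U k \<inter> {0..T} = U k" using U_sub by blast
    ultimately show ?thesis by (simp add: integrable_restrict_Int)
  qed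
  show ?thesis
  proof (rule integrable_spike_finite[OF _ _ integrable_add[OF int[of True] int[of False]]])
    show "finite (S \<union> {0, T})" using S(1) by simp
    fix t assume t: "t \<in> {0..T} - (S \<union> {0, T})"
    show "g (x t) (u t) = (if t \<in> U True then g (x t) True else 0) + (if t \<in> U False then g (x t) False else 0)"
      using t by (cases "u t") (auto simp: U_def)
  qed
qed

lemma integral_observable_arc:
  fixes g :: "real \<Rightarrow> bool \<Rightarrow> real" and a b :: real
  assumes "\<And>t. t \<in> {a<..<b} \<Longrightarrow> u t = k" "\<And>t. t \<in> {a<..<b} \<Longrightarrow> x t = y t"
  shows "integral {a..b} (\<lambda>t. g (x t) (u t)) = integral {a..b} (\<lambda>t. g (y t) k)"
proof (rule integral_spike[where S="{a, b}"])
  fix t assume "t \<in> {a..b} - {a, b}"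
  then have "t \<in> {a<..<b}" by (auto simp: less_le)
  with assms show "g (y t) k = g (x t) (u t)" by simp
qed simp

end

section \<open>Counting the starts of the engine\<close>

text \<open>\<open>card\<close> of an infinite set is 0, so comparing values of
  \<open>switch_ons\<close> through an injection requires this finiteness. A time outside
  \<open>S\<close> has a neighbourhood with constant control and cannot be a jump.\<close>

lemma finite_switch_set:
  assumes "piecewise_constant T u"
  shows "finite {t \<in> {0<..<T}. (\<forall>\<^sub>F s in at_left t. \<not> u s) \<and> (\<forall>\<^sub>F s in at_right t. u s)}"
proof -
  obtain S where S: "finite S"
    "\<And>a b. 0 \<le> a \<Longrightarrow> a < b \<Longrightarrow> b \<le> T \<Longrightarrow> {a<..<b} \<inter> S = {} \<Longrightarrow> u constant_on {a<..<b}"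
    using assms unfolding piecewise_constant_def by metis
  have "t \<in> S" if t: "0 < t" "t < T" and l: "\<forall>\<^sub>F s in at_left t. \<not> u s" and r: "\<forall>\<^sub>F s in at_right t. u s" for t
  proof (rule ccontr)
    assume tS: "t \<notin> S"
    obtain e where e: "e > 0" "\<And>s. s \<in> S \<Longrightarrow> s \<noteq> t \<Longrightarrow> e \<le> \<bar>s - t\<bar>"
      using finite_set_avoid[OF S(1), of t] by (auto simp: dist_real_def abs_minus_commute)
    obtain b1 where b1: "b1 < t" "\<And>s. b1 < s \<Longrightarrow> s < t \<Longrightarrow> \<not> u s"
      using l unfolding eventually_at_left_field by blast
    obtain b2 where b2: "t < b2" "\<And>s. t < s \<Longrightarrow> s < b2 \<Longrightarrow> u s"
      using r unfolding eventually_at_right_field by blast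
    define a where "a = Max {0, t - e, b1}"
    define b where "b = Min {T, t + e, b2}"
    have ab: "0 \<le> a" "t - e \<le> a" "b1 \<le> a" "a < t" "t < b" "b \<le> T" "b \<le> t + e" "b \<le> b2"
      using b1 b2 e(1) t by (auto simp: a_def b_def)
    have "s \<notin> S" if "s \<in> {a<..<b}" for s
      using e(2)[of s] tS that ab by (cases "s = t") (auto simp: abs_if split: if_splits)
    then have "{a<..<b} \<inter> S = {}" by blast
    then have "u constant_on {a<..<b}" using S(2)[of a b] ab by linarith
    moreover have "(a + t) / 2 \<in> {a<..<b}" "(t + b) / 2 \<in> {a<..<b}" using ab by auto
    ultimately have "u ((a + t) / 2) = u ((t + b) / 2)" unfolding constant_on_def by metis
    moreover have "\<not> u ((a + t) / 2)" using b1(2)[of "(a + t) / 2"] ab by auto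
    moreover have "u ((t + b) / 2)" using b2(2)[of "(t + b) / 2"] ab by auto
    ultimately show False by simp
  qed
  then show ?thesis by (intro finite_subset[OF _ S(1)]) auto
qed

text \<open>The time change maps jumps of the composed control injectively to jumps of
  \<open>u\<close>.\<close>

lemma switch_ons_reparametrize:
  assumes pc: "piecewise_constant T u"
    and \<theta>: "continuous_on {0..T'} \<theta>" "strict_mono_on {0..T'} \<theta>" "\<theta> 0 = 0" "\<theta> T' = T"
  shows "switch_ons T' (\<lambda>t. u (\<theta> t)) \<le> switch_ons T u"
  unfolding switch_ons_def
proof (rule card_inj_on_le[where f=\<theta>])
  let ?A = "{t \<in> {0<..<T'}. (\<forall>\<^sub>F s in at_left t. \<not> u (\<theta> s)) \<and> (\<forall>\<^sub>F s in at_right t. u (\<theta> s))}"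
  have mono: "\<theta> s < \<theta> t" if "0 \<le> s" "s < t" "t \<le> T'" for s t
    using \<theta>(2) that by (auto simp: strict_mono_on_def)
  \<comment> \<open>Every time near \<open>\<theta> t\<close> is the image of a time on the same
    side of \<open>t\<close>, so the one-sided limits of \<open>u\<close> at
    \<open>\<theta> t\<close> can be read off from the composed control.\<close>
  have ivt: "\<exists>s. a < s \<and> s < b \<and> \<theta> s = y" if ab: "0 \<le> a" "a < b" "b \<le> T'" and y: "\<theta> a < y" "y < \<theta> b" for a b y
  proof -
    have "continuous_on {a..b} \<theta>" by (rule continuous_on_subset[OF \<theta>(1)]) (use ab in auto)
    then obtain s where "a \<le> s" "s \<le> b" "\<theta> s = y" using IVT'[of \<theta> a y b] ab y by auto
    then show ?thesis using y by (intro exI[of _ s]) (auto simp: order_less_le)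
  qed
  show "inj_on \<theta> ?A"
    by (rule inj_on_subset[OF strict_mono_on_imp_inj_on[OF \<theta>(2)]]) auto
  show "finite {t \<in> {0<..<T}. (\<forall>\<^sub>F s in at_left t. \<not> u s) \<and> (\<forall>\<^sub>F s in at_right t. u s)}"
    by (rule finite_switch_set[OF pc])
  show "\<theta> ` ?A \<subseteq> {t \<in> {0<..<T}. (\<forall>\<^sub>F s in at_left t. \<not> u s) \<and> (\<forall>\<^sub>F s in at_right t. u s)}"
  proof clarsimp
    fix t assume t: "0 < t" "t < T'" and l: "\<forall>\<^sub>F s in at_left t. \<not> u (\<theta> s)" and r: "\<forall>\<^sub>F s in at_right t. u (\<theta> s)"
    obtain b1 where b1: "b1 < t" "\<And>s. b1 < s \<Longrightarrow> s < t \<Longrightarrow> \<not> u (\<theta> s)"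
      using l unfolding eventually_at_left_field by blast
    obtain b2 where b2: "t < b2" "\<And>s. t < s \<Longrightarrow> s < b2 \<Longrightarrow> u (\<theta> s)"
      using r unfolding eventually_at_right_field by blast
    have "\<forall>y>\<theta> (max 0 b1). y < \<theta> t \<longrightarrow> \<not> u y" "\<theta> (max 0 b1) < \<theta> t"
      using ivt[of "max 0 b1" t] b1 t mono by force+
    moreover have "\<forall>y>\<theta> t. y < \<theta> (min T' b2) \<longrightarrow> u y" "\<theta> t < \<theta> (min T' b2)"
      using ivt[of t "min T' b2"] b2 t mono by force+
    ultimately show "0 < \<theta> t \<and> \<theta> t < T \<and> (\<forall>\<^sub>F s in at_left (\<theta> t). \<not> u s) \<and> (\<forall>\<^sub>F s in at_right (\<theta> t). u s)"
      using mono[of 0 t] mono[of t T'] t \<theta>(3,4)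
      unfolding eventually_at_left_field eventually_at_right_field by auto
  qed
qed

section \<open>Replacing a part of a trajectory\<close>

lemma integral_split4:
  fixes \<phi> :: "real \<Rightarrow> real"
  assumes "\<phi> integrable_on {a..e}" "a \<le> b" "b \<le> c" "c \<le> d" "d \<le> e"
  shows "integral {a..e} \<phi> = integral {a..b} \<phi> + integral {b..c} \<phi> + integral {c..d} \<phi> + integral {d..e} \<phi>"
proof -
  have sub: "\<phi> integrable_on {r..s}" if "a \<le> r" "s \<le> e" for r s
    by (rule integrable_subinterval_real[OF assms(1)]) (use that in auto)
  have "integral {a..e} \<phi> = integral {a..b} \<phi> + integral {b..e} \<phi>"
    "integral {b..e} \<phi> = integral {b..c} \<phi> + integral {c..e} \<phi>"
    "integral {c..e} \<phi> = integral {c..d} \<phi> + integral {d..e} \<phi>"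
    by (rule Henstock_Kurzweil_Integration.integral_combine[symmetric]; use assms sub in simp)+
  then show ?thesis by simp
qed

context control_system begin

text \<open>\<open>\<xi>\<close> is anchored at the start \<open>p\<close> and \<open>\<eta>\<close>
  at the end \<open>q\<close>, each on its own clock; \<open>\<xi>\<close> is left at
  \<open>\<sigma>\<close>, \<open>\<eta>\<close> is entered at \<open>e\<close>, and the mismatch of
  the two clocks is the gained time \<open>\<sigma> - e\<close>. Stating the integral formula for
  every observable \<open>g\<close> yields distance and running cost at once.\<close>

lemma splice:
  assumes tr: "trajectory T u x" and pmq: "0 \<le> p" "p < m" "m < q" "q \<le> T"
    and u_k: "\<And>t. t \<in> {p<..<m} \<Longrightarrow> u t = k" and u_l: "\<And>t. t \<in> {m<..<q} \<Longrightarrow> u t = l"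
    and \<xi>: "arc k \<xi> {p..\<sigma>}" "p < \<sigma>" "\<xi> p = x p"
    and \<eta>: "arc l \<eta> {e..q}" "e < q" "\<eta> q = x q"
    and join: "\<xi> \<sigma> = \<eta> e"
  obtains v y where "trajectory (T + (\<sigma> - e)) v y" "p \<le> T + (\<sigma> - e)"
    "\<And>t. t \<in> {0..p} \<Longrightarrow> v t = u t" "\<And>t. t \<in> {0..p} \<Longrightarrow> y t = x t"
    "switch_ons (T + (\<sigma> - e)) v \<le> switch_ons T u"
    "\<And>g. (\<And>b. continuous_on UNIV (\<lambda>z. g z b)) \<Longrightarrow>
      integral {0..T + (\<sigma> - e)} (\<lambda>t. g (y t) (v t)) = integral {0..T} (\<lambda>t. g (x t) (u t))
        + (integral {p..\<sigma>} (\<lambda>t. g (\<xi> t) k) - integral {p..m} (\<lambda>t. g (x t) k))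
        + (integral {e..q} (\<lambda>t. g (\<eta> t) l) - integral {m..q} (\<lambda>t. g (x t) l) :: real)"
proof -
  define w where "w = \<sigma> - e"
  define r1 where "r1 = (m - p) / (\<sigma> - p)"
  define r2 where "r2 = (q - m) / (q - e)"
  define \<theta> where "\<theta> t = min t p + r1 * max 0 (min (t - p) (\<sigma> - p))
    + r2 * max 0 (min (t - \<sigma>) (q - e)) + max 0 (t - (q + w))" for t
  \<comment> \<open>\<^term>\<open>\<theta>\<close> is increasing and piecewise affine, with breakpoints sent to \<^term>\<open>p\<close>, \<^term>\<open>m\<close>,
    \<^term>\<open>q\<close>; since the new control is \<^term>\<open>u\<close> after a change of time, it does not switch on more often.\<close>
  define v where "v t = u (\<theta> t)" for t
  define y where "y t = (if t \<le> p then x t else if t \<le> \<sigma> then \<xi> t else if t \<le> q + w then \<eta> (t - w) else x (t - w))" for t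
  have r: "r1 > 0" "r2 > 0" "r1 * (\<sigma> - p) = m - p" "r2 * (q - e) = q - m"
    using pmq \<xi>(2) \<eta>(2) by (auto simp: r1_def r2_def)
  have ord: "\<sigma> < q + w" "0 < \<sigma>" "q + w \<le> T + w"
    using \<xi>(2) \<eta>(2) pmq by (auto simp: w_def)
  have \<theta>1: "\<theta> t = t" if "t \<le> p" for t
    using that \<xi>(2) \<eta>(2) ord by (auto simp: \<theta>_def min_def max_def)
  have \<theta>2: "\<theta> t = p + r1 * (t - p)" if "p \<le> t" "t \<le> \<sigma>" for t
    using that ord \<eta>(2) by (auto simp: \<theta>_def min_def max_def)
  have \<theta>3: "\<theta> t = m + r2 * (t - \<sigma>)" if "\<sigma> \<le> t" "t \<le> q + w" for t
    using that \<xi>(2) \<eta>(2) r(3) by (auto simp: \<theta>_def min_def max_def w_def)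
  have \<theta>4: "\<theta> t = t - w" if "q + w \<le> t" for t
  proof -
    have "min t p = p" "max 0 (min (t - p) (\<sigma> - p)) = \<sigma> - p" "max 0 (min (t - \<sigma>) (q - e)) = q - e"
      "max 0 (t - (q + w)) = t - (q + w)"
      using that \<xi>(2) \<eta>(2) ord by (auto simp: w_def)
    then show ?thesis unfolding \<theta>_def using r(3,4) by simp
  qed
  have \<theta>_cont: "continuous_on A \<theta>" for A
    unfolding \<theta>_def by (intro continuous_intros)
  have \<theta>_mono: "strict_mono_on A \<theta>" for A
  proof (rule strict_mono_onI)
    fix s t :: real assume st: "s < t"
    define d1 where "d1 = min t p - min s p"
    define d2 where "d2 = max 0 (min (t - p) (\<sigma> - p)) - max 0 (min (s - p) (\<sigma> - p))"
    define d3 where "d3 = max 0 (min (t - \<sigma>) (q - e)) - max 0 (min (s - \<sigma>) (q - e))"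
    define d4 where "d4 = max 0 (t - (q + w)) - max 0 (s - (q + w))"
    have nn: "d1 \<ge> 0" "d2 \<ge> 0" "d3 \<ge> 0" "d4 \<ge> 0"
      using st by (auto simp: d1_def d2_def d3_def d4_def)
    \<comment> \<open>The clamped pieces of \<open>\<theta>\<close> without their slopes add up to
      the identity, so at least one of the nonnegative increments is positive; all slopes are
      positive.\<close>
    have sum: "min t p + max 0 (min (t - p) (\<sigma> - p)) + max 0 (min (t - \<sigma>) (q - e)) + max 0 (t - (q + w)) = t" for t
      using \<xi>(2) \<eta>(2) by (auto simp: min_def max_def w_def)
    have "d1 + d2 + d3 + d4 = t - s"
      using sum[of t] sum[of s] by (simp add: d1_def d2_def d3_def d4_def)
    then have "d1 + r1 * d2 + r2 * d3 + d4 > 0"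
      using nn r(1,2) st
      by (smt (verit, best) mult_nonneg_nonneg mult_pos_pos)
    moreover have "\<theta> t - \<theta> s = d1 + r1 * d2 + r2 * d3 + d4"
      by (simp add: \<theta>_def d1_def d2_def d3_def d4_def algebra_simps)
    ultimately show "\<theta> s < \<theta> t" by simp
  qed
  have v2: "v t = k" if "p < t" "t < \<sigma>" for t
  proof -
    have "r1 * (t - p) < r1 * (\<sigma> - p)" "0 < r1 * (t - p)" using r(1) that by simp_all
    then have "\<theta> t \<in> {p<..<m}" using \<theta>2[of t] that r(3) by simp
    then show ?thesis unfolding v_def by (rule u_k)
  qed
  have v3: "v t = l" if "\<sigma> < t" "t < q + w" for t
  proof -
    have "r2 * (t - \<sigma>) < r2 * (q - e)" "0 < r2 * (t - \<sigma>)" using r(2) that by (simp_all add: w_def)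
    then have "\<theta> t \<in> {m<..<q}" using \<theta>3[of t] that r(4) by simp
    then show ?thesis unfolding v_def by (rule u_l)
  qed
  obtain S where cont: "continuous_on {0..T} x" and S: "finite S"
    "\<And>t. t \<in> {0<..<T} - S \<Longrightarrow> (x has_real_derivative f (x t) (u t)) (at t)"
    "\<And>t. t \<in> {0<..<T} - S \<Longrightarrow> (\<forall>\<^sub>F s in nhds t. u s = u t)"
    using tr unfolding trajectory_def by blast
  have y_cont: "continuous_on {0..T + w} y"
    unfolding y_def
  proof (intro continuous_on_cases_le continuous_intros)
    show "continuous_on {t \<in> {0..T + w}. t \<le> p} x"
      by (rule continuous_on_subset[OF cont]) (use pmq in auto)
    show "continuous_on {t \<in> {t \<in> {0..T + w}. p \<le> t}. t \<le> \<sigma>} \<xi>"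
      by (rule continuous_on_subset[OF arc_continuous_on[OF \<xi>(1)]]) auto
    show "continuous_on {t \<in> {t \<in> {t \<in> {0..T + w}. p \<le> t}. \<sigma> \<le> t}. t \<le> q + w} (\<lambda>t. \<eta> (t - w))"
      by (rule continuous_on_compose2[OF arc_continuous_on[OF \<eta>(1)]]) (auto intro!: continuous_intros simp: w_def)
    show "continuous_on {t \<in> {t \<in> {t \<in> {0..T + w}. p \<le> t}. \<sigma> \<le> t}. q + w \<le> t} (\<lambda>t. x (t - w))"
      by (rule continuous_on_compose2[OF cont]) (use pmq in \<open>auto intro!: continuous_intros\<close>)
    show "x t = (if t \<le> \<sigma> then \<xi> t else if t \<le> q + w then \<eta> (t - w) else x (t - w))" if "t = p" for t
      using that \<xi> by simp
    show "\<xi> t = (if t \<le> q + w then \<eta> (t - w) else x (t - w))" if "t = \<sigma>" for t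
      using that join ord by (simp add: w_def)
    show "\<eta> (t - w) = x (t - w)" if "t = q + w" for t
      using that \<eta> by simp
  qed
  \<comment> \<open>Being a solution is local, so on each open piece \<open>y\<close> and
    \<open>v\<close> are compared with a model solution \<open>z\<close> under a model control
    \<open>b\<close>.\<close>
  have piece: "(y has_real_derivative f (y t) (v t)) (at t) \<and> (\<forall>\<^sub>F s in nhds t. v s = v t)"
    if A: "open A" "t \<in> A" "\<And>s. s \<in> A \<Longrightarrow> y s = z s \<and> v s = b s"
      and z: "(z has_real_derivative f (z t) (b t)) (at t)" and b: "\<forall>\<^sub>F s in nhds t. b s = b t" for A t z b
  proof
    have eq: "y t = z t" "v t = b t" using A by auto
    show "(y has_real_derivative f (y t) (v t)) (at t)"
      unfolding eq by (rule has_field_derivative_transform_within_open[OF z A(1,2)]) (use A(3) in simp)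
    show "\<forall>\<^sub>F s in nhds t. v s = v t"
      using b eventually_nhds_in_open[OF A(1,2)] by eventually_elim (use A(3) eq in simp)
  qed
  have "trajectory (T + w) v y"
    unfolding trajectory_def
  \<comment> \<open>The exceptional times of \<open>x\<close> occur unshifted before the window and
    delayed by \<open>w\<close> after it; the other three points are the joints.\<close>
  proof (intro conjI exI[of _ "S \<union> (\<lambda>s. s + w) ` S \<union> {p, \<sigma>, q + w}"] y_cont ballI)
    show "finite (S \<union> (\<lambda>s. s + w) ` S \<union> {p, \<sigma>, q + w})" using S(1) by simp
    fix t assume t: "t \<in> {0<..<T + w} - (S \<union> (\<lambda>s. s + w) ` S \<union> {p, \<sigma>, q + w})"
    have tw: "t - w \<notin> S"
    proof
      assume "t - w \<in> S"
      then have "(t - w) + w \<in> (\<lambda>s. s + w) ` S" by (rule imageI)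
      with t show False by simp
    qed
    from t consider "t < p" | "p < t" "t < \<sigma>" | "\<sigma> < t" "t < q + w" | "q + w < t" by fastforce
    then have "(y has_real_derivative f (y t) (v t)) (at t) \<and> (\<forall>\<^sub>F s in nhds t. v s = v t)"
    proof cases
      case 1
      then have t': "t \<in> {0<..<T} - S" using t pmq by auto
      show ?thesis
        by (rule piece[of "{..<p}" t x u]) (use 1 S(2,3)[OF t'] \<theta>1 in \<open>auto simp: y_def v_def\<close>)
    next
      case 2
      show ?thesis
        by (rule piece[of "{p<..<\<sigma>}" t \<xi> "\<lambda>_. k"])
          (use 2 arc_interiorD[OF \<xi>(1), of t] v2 in \<open>auto simp: y_def\<close>)
    next
      case 3
      have "arc l (\<lambda>t. \<eta> (t - w)) {\<sigma>..q + w}"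
        using arc_shift[OF \<eta>(1), of w] by (simp add: w_def)
      then show ?thesis
        by (intro piece[of "{\<sigma><..<q + w}" t "\<lambda>t. \<eta> (t - w)" "\<lambda>_. l"])
          (use 3 \<xi>(2) arc_interiorD[of l _ \<sigma> "q + w" t] v3 in \<open>auto simp: y_def\<close>)
    next
      case 4
      then have t': "t - w \<in> {0<..<T} - S" using t tw pmq by auto
      have "((\<lambda>t. x (t - w)) has_real_derivative f (x (t - w)) (u (t - w))) (at t)"
        using S(2)[OF t'] DERIV_shift[of x _ t "- w"] by simp
      moreover have "filterlim (\<lambda>s. s - w) (nhds (t - w)) (nhds t)"
        by (intro tendsto_intros filterlim_ident)
      then have "\<forall>\<^sub>F s in nhds t. u (s - w) = u (t - w)"
        using S(3)[OF t'] by (rule eventually_compose_filterlim[rotated])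
      ultimately show ?thesis
        using 4 ord \<xi>(2) \<theta>4 by (intro piece[of "{q + w<..}" t "\<lambda>t. x (t - w)" "\<lambda>t. u (t - w)"]) (auto simp: y_def v_def)
    qed
    then show "(y has_real_derivative f (y t) (v t)) (at t)" "\<forall>\<^sub>F s in nhds t. v s = v t" by blast+
  qed
  moreover have "switch_ons (T + w) v \<le> switch_ons T u"
    unfolding v_def
    by (rule switch_ons_reparametrize[OF trajectory_piecewise_constant[OF tr] \<theta>_cont \<theta>_mono])
      (use \<theta>1 \<theta>4 pmq in auto)
  moreover have "integral {0..T + w} (\<lambda>t. g (y t) (v t)) = integral {0..T} (\<lambda>t. g (x t) (u t))
        + (integral {p..\<sigma>} (\<lambda>t. g (\<xi> t) k) - integral {p..m} (\<lambda>t. g (x t) k))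
        + (integral {e..q} (\<lambda>t. g (\<eta> t) l) - integral {m..q} (\<lambda>t. g (x t) l))"
    if g: "\<And>b. continuous_on UNIV (\<lambda>z. g z b)" for g :: "real \<Rightarrow> bool \<Rightarrow> real"
  proof -
    let ?\<phi> = "\<lambda>t. g (x t) (u t)" and ?\<psi> = "\<lambda>t. g (y t) (v t)"
    have "integral {0..T} ?\<phi> = integral {0..p} ?\<phi> + integral {p..m} ?\<phi> + integral {m..q} ?\<phi> + integral {q..T} ?\<phi>"
      using pmq by (intro integral_split4 trajectory_integrable[OF tr g]) auto
    moreover have "integral {0..T + w} ?\<psi> = integral {0..p} ?\<psi> + integral {p..\<sigma>} ?\<psi> + integral {\<sigma>..q + w} ?\<psi> + integral {q + w..T + w} ?\<psi>"
      using pmq \<xi>(2) ord by (intro integral_split4 trajectory_integrable[OF \<open>trajectory (T + w) v y\<close> g]) auto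
    moreover have "integral {0..p} ?\<psi> = integral {0..p} ?\<phi>"
      by (rule integral_cong) (simp add: y_def v_def \<theta>1)
    moreover have "integral {p..m} ?\<phi> = integral {p..m} (\<lambda>t. g (x t) k)"
      "integral {m..q} ?\<phi> = integral {m..q} (\<lambda>t. g (x t) l)"
      by (rule integral_observable_arc; use u_k u_l in simp)+
    moreover have "integral {p..\<sigma>} ?\<psi> = integral {p..\<sigma>} (\<lambda>t. g (\<xi> t) k)"
      by (rule integral_observable_arc) (use v2 in \<open>auto simp: y_def\<close>)
    moreover have "integral {\<sigma>..q + w} ?\<psi> = integral {\<sigma>..q + w} (\<lambda>t. g (\<eta> (t - w)) l)"
      by (rule integral_observable_arc) (use v3 \<xi>(2) in \<open>auto simp: y_def\<close>)
    moreover have "integral {\<sigma>..q + w} (\<lambda>t. g (\<eta> (t - w)) l) = integral {e..q} (\<lambda>t. g (\<eta> t) l)"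
    proof -
      have "\<sigma> = e + w" by (simp add: w_def)
      then show ?thesis using integral_shift_real_ivl[of e "- w" q "\<lambda>t. g (\<eta> t) l"] by simp
    qed
    moreover have "integral {q + w..T + w} ?\<psi> = integral {q + w..T + w} (\<lambda>t. ?\<phi> (t - w))"
    proof (rule integral_spike[of "{q + w}"])
      fix t assume "t \<in> {q + w..T + w} - {q + w}"
      then show "?\<phi> (t - w) = ?\<psi> t" using \<theta>4[of t] ord \<xi>(2) by (auto simp: y_def v_def)
    qed simp
    moreover have "integral {q + w..T + w} (\<lambda>t. ?\<phi> (t - w)) = integral {q..T} ?\<phi>"
      using integral_shift_real_ivl[of q "- w" T ?\<phi>] by simp
    ultimately show ?thesis by simp
  qed
  ultimately show thesis
    using \<theta>1 pmq ord \<xi>(2) by (intro that[of v y]) (auto simp: v_def y_def w_def[symmetric])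
qed

text \<open>Only agreement on $[0,b]$ is required and only agreement on $[0,a]$ is returned, so that
  several windows can be replaced one after the other, from right to left, without shifting the
  windows that remain.\<close>

definition replaceable_window ::
  "(real \<Rightarrow> bool) \<Rightarrow> (real \<Rightarrow> real) \<Rightarrow> real \<Rightarrow> real \<Rightarrow> real \<Rightarrow> (real \<Rightarrow> real) \<Rightarrow> (real \<Rightarrow> real) \<Rightarrow> bool" where
  "replaceable_window u x a b w0 D J \<longleftrightarrow>
     (\<forall>w T u' x'. \<bar>w\<bar> < w0 \<longrightarrow> trajectory T u' x' \<longrightarrow> b \<le> T \<longrightarrow>
        (\<forall>t\<in>{0..b}. u' t = u t \<and> x' t = x t) \<longrightarrow>
        (\<exists>v y. trajectory (T + w) v y \<and> a \<le> T + w \<and> (\<forall>t\<in>{0..a}. v t = u t \<and> y t = x t) \<and>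
           integral {0..T + w} y = integral {0..T} x' + D w \<and>
           integral {0..T + w} (\<lambda>t. h (y t) (v t)) = integral {0..T} (\<lambda>t. h (x' t) (u' t)) + J w \<and>
           switch_ons (T + w) v \<le> switch_ons T u'))"

text \<open>\<open>c\<close> and \<open>\<rho>\<close> are the rates of distance and of running cost
  per unit of gained time. Continuity of \<open>D\<close> near 0 serves the intermediate value
  theorem that restores the distance exactly; for \<open>J\<close> the derivative at 0
  suffices.\<close>

definition adjustable :: "(real \<Rightarrow> bool) \<Rightarrow> (real \<Rightarrow> real) \<Rightarrow> real \<Rightarrow> real \<Rightarrow> real \<Rightarrow> real \<Rightarrow> bool" where
  "adjustable u x a b c \<rho> \<longleftrightarrow> (\<exists>w0>0. \<exists>D J. D 0 = 0 \<and> J 0 = 0 \<and>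
     continuous_on {-w0<..<w0} D \<and> (D has_real_derivative c) (at 0) \<and> (J has_real_derivative \<rho>) (at 0) \<and>
     replaceable_window u x a b w0 D J)"

text \<open>\<open>splice\<close> is applied with \<open>\<xi>\<close> left at \<open>G w\<close>
  and \<open>\<eta>\<close> entered at \<open>G w - w\<close>, which changes the duration by
  \<open>w\<close>. To first order \<gamma> w is added in mode \<open>k\<close> and (1 - \<gamma>) w
  in mode \<open>l\<close>, both at speed \<open>x m\<close>; hence the distance has rate
  \<open>x m\<close> whatever \<gamma> is.\<close>

lemma adjustable_family:
  assumes pmq: "0 \<le> p" "p < m" "m < q"
    and u_k: "\<And>t. t \<in> {p<..<m} \<Longrightarrow> u t = k" and u_l: "\<And>t. t \<in> {m<..<q} \<Longrightarrow> u t = l"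
    and \<xi>: "arc k \<xi> {p..\<sigma>}" "m < \<sigma>" "\<And>t. t \<in> {p..m} \<Longrightarrow> \<xi> t = x t"
    and \<eta>: "arc l \<eta> {e..q}" "e \<le> m" "\<And>t. t \<in> {m..q} \<Longrightarrow> \<eta> t = x t"
    and w0: "w0 > 0"
    and G: "continuous_on {-w0<..<w0} G" "G 0 = m" "(G has_real_derivative \<gamma>) (at 0)"
      "\<And>w. \<bar>w\<bar> < w0 \<Longrightarrow> G w \<in> {p<..\<sigma>}" "\<And>w. \<bar>w\<bar> < w0 \<Longrightarrow> G w - w \<in> {e..<q}"
      "\<And>w. \<bar>w\<bar> < w0 \<Longrightarrow> \<xi> (G w) = \<eta> (G w - w)"
  shows "adjustable u x p q (x m) (\<gamma> * h (x m) k + (1 - \<gamma>) * h (x m) l)"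
proof -
  have img: "G ` {-w0<..<w0} \<subseteq> {p..\<sigma>}" "(\<lambda>w. G w - w) ` {-w0<..<w0} \<subseteq> {e..q}"
  proof -
    have "G w \<in> {p..\<sigma>} \<and> G w - w \<in> {e..q}" if "w \<in> {-w0<..<w0}" for w
      using G(4,5)[of w] that by (auto simp: abs_less_iff)
    then show "G ` {-w0<..<w0} \<subseteq> {p..\<sigma>}" "(\<lambda>w. G w - w) ` {-w0<..<w0} \<subseteq> {e..q}" by blast+
  qed
  \<comment> \<open>\<open>K g w\<close> is the change of the integral of the observable
    \<open>g\<close>: the projection to the speed gives the distance, \<open>h\<close> the running
    cost.\<close>
  define K where "K g w = (integral {p..G w} (\<lambda>t. g (\<xi> t) k) - integral {p..m} (\<lambda>t. g (x t) k))
        + (integral {G w - w..q} (\<lambda>t. g (\<eta> t) l) - integral {m..q} (\<lambda>t. g (x t) l))"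
    for g :: "real \<Rightarrow> bool \<Rightarrow> real" and w
  have K: "K g 0 = 0" "continuous_on {-w0<..<w0} (K g)"
    "(K g has_real_derivative \<gamma> * g (x m) k + (1 - \<gamma>) * g (x m) l) (at 0)"
    if g: "\<And>b. continuous_on UNIV (\<lambda>z. g z b)" for g
  proof -
    have "integral {p..m} (\<lambda>t. g (\<xi> t) k) = integral {p..m} (\<lambda>t. g (x t) k)"
      "integral {m..q} (\<lambda>t. g (\<eta> t) l) = integral {m..q} (\<lambda>t. g (x t) l)"
      by (rule integral_cong, use \<xi>(3) \<eta>(3) in simp)+
    then show "K g 0 = 0" by (simp add: K_def G(2))
    have c\<xi>: "continuous_on {p..\<sigma>} (\<lambda>t. g (\<xi> t) k)" and c\<eta>: "continuous_on {e..q} (\<lambda>t. g (\<eta> t) l)"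
      using continuous_on_compose2[OF g arc_continuous_on[OF \<xi>(1)]] continuous_on_compose2[OF g arc_continuous_on[OF \<eta>(1)]]
      by auto
    note d\<xi> = integral_has_real_derivative[OF c\<xi>] and d\<eta> = integral_has_real_derivative'[OF c\<eta>]
    have "continuous_on {p..\<sigma>} (\<lambda>s. integral {p..s} (\<lambda>t. g (\<xi> t) k))"
      by (rule DERIV_continuous_on[OF d\<xi>])
    then have "continuous_on {-w0<..<w0} (\<lambda>w. integral {p..G w} (\<lambda>t. g (\<xi> t) k))"
      by (rule continuous_on_compose2[OF _ G(1) img(1)])
    moreover have "continuous_on {e..q} (\<lambda>s. integral {s..q} (\<lambda>t. g (\<eta> t) l))"
      by (rule DERIV_continuous_on[OF d\<eta>])
    then have "continuous_on {-w0<..<w0} (\<lambda>w. integral {G w - w..q} (\<lambda>t. g (\<eta> t) l))"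
      by (rule continuous_on_compose2[OF _ continuous_on_diff[OF G(1) continuous_on_id] img(2)])
    ultimately show "continuous_on {-w0<..<w0} (K g)"
      unfolding K_def by (intro continuous_intros)
    have m: "m \<in> {p..\<sigma>}" "m \<in> {e..q}" using pmq \<xi>(2) \<eta>(2) by auto
    \<comment> \<open>If \<open>e = m\<close>, only a one-sided derivative in the lower limit is
      available at \<open>m\<close>. The chain rule is therefore used within the images of the
      parameter interval.\<close>
    have at0: "at (0::real) = at 0 within {-w0<..<w0}"
      using w0 by (intro at_within_open[symmetric]) auto
    have eqm: "g (\<xi> m) k = g (x m) k" "g (\<eta> m) l = g (x m) l"
      using \<xi>(3)[of m] \<eta>(3)[of m] pmq by auto
    have "((\<lambda>s. integral {p..s} (\<lambda>t. g (\<xi> t) k)) \<circ> G has_real_derivative g (x m) k * \<gamma>) (at 0)"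
      unfolding at0
    proof (rule DERIV_image_chain)
      show "((\<lambda>s. integral {p..s} (\<lambda>t. g (\<xi> t) k)) has_real_derivative g (x m) k) (at (G 0) within G ` {-w0<..<w0})"
        by (rule DERIV_subset[of _ _ _ "{p..\<sigma>}"]) (use d\<xi>[OF m(1)] G(2) eqm img(1) in auto)
      show "(G has_real_derivative \<gamma>) (at 0 within {-w0<..<w0})" using G(3) at0 by simp
    qed
    moreover have "((\<lambda>s. integral {s..q} (\<lambda>t. g (\<eta> t) l)) \<circ> (\<lambda>w. G w - w) has_real_derivative - g (x m) l * (\<gamma> - 1)) (at 0)"
      unfolding at0
    proof (rule DERIV_image_chain)
      show "((\<lambda>s. integral {s..q} (\<lambda>t. g (\<eta> t) l)) has_real_derivative - g (x m) l) (at (G 0 - 0) within (\<lambda>w. G w - w) ` {-w0<..<w0})"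
        by (rule DERIV_subset[OF _ img(2)]) (use d\<eta>[OF m(2)] G(2) eqm in auto)
      have "((\<lambda>w. G w - w) has_real_derivative \<gamma> - 1) (at 0)" using G(3) by (auto intro!: derivative_eq_intros)
      then show "((\<lambda>w. G w - w) has_real_derivative \<gamma> - 1) (at 0 within {-w0<..<w0})" using at0 by simp
    qed
    ultimately show "(K g has_real_derivative \<gamma> * g (x m) k + (1 - \<gamma>) * g (x m) l) (at 0)"
      unfolding K_def o_def by (auto intro!: derivative_eq_intros simp: algebra_simps)
  qed
  have surgery: "\<exists>v y. trajectory (T + w) v y \<and> p \<le> T + w \<and> (\<forall>t\<in>{0..p}. v t = u t \<and> y t = x t) \<and>
           integral {0..T + w} y = integral {0..T} x' + K (\<lambda>z b. z) w \<and>
           integral {0..T + w} (\<lambda>t. h (y t) (v t)) = integral {0..T} (\<lambda>t. h (x' t) (u' t)) + K h w \<and>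
           switch_ons (T + w) v \<le> switch_ons T u'"
    if w: "\<bar>w\<bar> < w0" and tr: "trajectory T u' x'" and q: "q \<le> T" and agree: "\<And>t. t \<in> {0..q} \<Longrightarrow> u' t = u t \<and> x' t = x t"
    for w T u' x'
  proof -
    have Gw: "G w \<in> {p<..\<sigma>}" "G w - w \<in> {e..<q}" "\<xi> (G w) = \<eta> (G w - w)" using G(4-6) w by auto
    have x': "integral {p..m} (\<lambda>t. g (x' t) k) = integral {p..m} (\<lambda>t. g (x t) k)"
      "integral {m..q} (\<lambda>t. g (x' t) l) = integral {m..q} (\<lambda>t. g (x t) l)" for g :: "real \<Rightarrow> bool \<Rightarrow> real"
      by (rule integral_cong, use agree pmq in simp)+
    obtain v y where vy: "trajectory (T + (G w - (G w - w))) v y" "p \<le> T + (G w - (G w - w))"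
      "\<And>t. t \<in> {0..p} \<Longrightarrow> v t = u' t" "\<And>t. t \<in> {0..p} \<Longrightarrow> y t = x' t"
      "switch_ons (T + (G w - (G w - w))) v \<le> switch_ons T u'"
      "\<And>g. (\<And>b. continuous_on UNIV (\<lambda>z. g z b)) \<Longrightarrow>
        integral {0..T + (G w - (G w - w))} (\<lambda>t. g (y t) (v t)) = integral {0..T} (\<lambda>t. g (x' t) (u' t))
        + (integral {p..G w} (\<lambda>t. g (\<xi> t) k) - integral {p..m} (\<lambda>t. g (x' t) k))
        + (integral {G w - w..q} (\<lambda>t. g (\<eta> t) l) - integral {m..q} (\<lambda>t. g (x' t) l) :: real)"
    proof (rule splice[OF tr pmq(1-3) q, of k l \<xi> "G w" \<eta> "G w - w"])
      show "arc k \<xi> {p..G w}" "arc l \<eta> {G w - w..q}"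
        using arc_subset[OF \<xi>(1)] arc_subset[OF \<eta>(1)] Gw by auto
    qed (use u_k u_l agree pmq Gw \<xi>(3) \<eta>(3) in auto)
    have int: "integral {0..T + w} (\<lambda>t. g (y t) (v t)) = integral {0..T} (\<lambda>t. g (x' t) (u' t)) + K g w"
      if "\<And>b. continuous_on UNIV (\<lambda>z. g z b)" for g :: "real \<Rightarrow> bool \<Rightarrow> real"
      using vy(6)[of g] that by (simp add: K_def x')
    have "integral {0..T + w} y = integral {0..T} x' + K (\<lambda>z b. z) w"
      using int[of "\<lambda>z b. z"] by simp
    moreover have "integral {0..T + w} (\<lambda>t. h (y t) (v t)) = integral {0..T} (\<lambda>t. h (x' t) (u' t)) + K h w"
      by (rule int[OF cont_h])
    ultimately show ?thesis using vy(1-5) agree pmq by (intro exI[of _ v] exI[of _ y]) auto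
  qed
  have "(K (\<lambda>z b. z) has_real_derivative x m) (at 0)"
    using K(3)[of "\<lambda>z b. z"] by (simp add: algebra_simps)
  then show ?thesis
    unfolding adjustable_def replaceable_window_def
    using w0 K(1,2)[of "\<lambda>z b. z"] K(1,3)[OF cont_h] surgery
    by (intro exI[of _ w0] conjI exI[of _ "K (\<lambda>z b. z)"] exI[of _ "K h"]) auto
qed

end

section \<open>Adjustability of local extrema\<close>

lemma the_inv_into_Icc_continuous_on:
  fixes f :: "real \<Rightarrow> real"
  assumes "continuous_on {a..b} f" "inj_on f {a..b}"
  shows "continuous_on (f ` {a..b}) (the_inv_into {a..b} f)"
  using continuous_on_inv_into[OF assms(1) compact_Icc assms(2)] .

text \<open>$G(w)$ is the point at which to leave the graph of $X$ for that of $Y$ if the time $w$ is to be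
  gained: the two branches have the same value at $G(w)$ and $G(w) - w$.\<close>

lemma opposite_monotone_parametrization:
  fixes X Y :: "real \<Rightarrow> real"
  assumes X: "continuous_on {p..\<sigma>} X" "\<And>s t. p \<le> s \<Longrightarrow> s \<le> t \<Longrightarrow> t \<le> \<sigma> \<Longrightarrow> X s \<le> X t"
    and Y: "continuous_on {e..q} Y" "\<And>s t. e \<le> s \<Longrightarrow> s < t \<Longrightarrow> t \<le> q \<Longrightarrow> Y t < Y s"
    and m: "p < m" "m < \<sigma>" "e \<le> m" "m < q" and eq: "X m = Y m" and top: "X \<sigma> \<le> Y e"
  obtains w0 G where "w0 > 0" "continuous_on {-w0<..<w0} G" "G 0 = m"
    "\<And>w. \<bar>w\<bar> < w0 \<Longrightarrow> G w \<in> {p<..\<sigma>}" "\<And>w. \<bar>w\<bar> < w0 \<Longrightarrow> G w - w \<in> {e..<q}"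
    "\<And>w. \<bar>w\<bar> < w0 \<Longrightarrow> X (G w) = Y (G w - w)"
proof -
  have "Y q < X m" using Y(2)[of m q] m eq by simp
  moreover have "m \<in> {p..\<sigma>}" using m by simp
  ultimately obtain d where d: "d > 0" "\<And>s. s \<in> {p..\<sigma>} \<Longrightarrow> dist s m < d \<Longrightarrow> dist (X s) (X m) < X m - Y q"
    using X(1) unfolding continuous_on_iff by (metis diff_gt_0_iff_gt)
  \<comment> \<open>Close enough to \<open>m\<close> that \<open>X\<close> stays above
    \<open>Y q\<close> from \<open>\<sigma>0\<close> on, so that \<open>Y\<close> takes every level
    that \<open>X\<close> takes on \<open>{\<sigma>0..\<sigma>}\<close>.\<close>
  define \<sigma>0 where "\<sigma>0 = max ((p + m) / 2) (m - d / 2)"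
  have \<sigma>0: "p < \<sigma>0" "\<sigma>0 < m" using m d(1) by (auto simp: \<sigma>0_def less_max_iff_disj)
  have "dist (X \<sigma>0) (X m) < X m - Y q"
    by (rule d(2)) (use m \<sigma>0 d(1) in \<open>auto simp: dist_real_def \<sigma>0_def\<close>)
  then have X\<sigma>0: "Y q < X \<sigma>0" by (auto simp: dist_real_def)
  have injY: "inj_on Y {e..q}"
    by (rule linorder_inj_onI) (use Y(2) in force)+
  define Yi where "Yi = the_inv_into {e..q} Y"
  have imY: "y \<in> Y ` {e..q}" if "Y q \<le> y" "y \<le> Y e" for y
    using IVT2'[of Y q y e] Y(1) that m by force
  \<comment> \<open>\<open>b s\<close> is the time at which the falling branch has the level
    \<open>X s\<close>. Switching branches at \<open>s\<close> gains the time
    \<open>s - b s\<close>, and \<open>G\<close> will be the inverse of this function.\<close>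
  define b where "b s = Yi (X s)" for s
  have Xim: "X s \<in> Y ` {e..q}" "Y q < X s" if "s \<in> {\<sigma>0..\<sigma>}" for s
    using imY[of "X s"] X(2)[of \<sigma>0 s] X(2)[of s \<sigma>] X\<sigma>0 top \<sigma>0 m that by auto
  have b: "b s \<in> {e..<q}" "Y (b s) = X s" if "s \<in> {\<sigma>0..\<sigma>}" for s
  proof -
    show *: "Y (b s) = X s"
      unfolding b_def Yi_def by (rule f_the_inv_into_f[OF injY Xim(1)[OF that]])
    have "b s \<in> {e..q}"
      unfolding b_def Yi_def by (rule the_inv_into_into[OF injY Xim(1)[OF that]]) simp
    moreover have "b s \<noteq> q" using * Xim(2)[OF that] by auto
    ultimately show "b s \<in> {e..<q}" by auto
  qed
  have b_anti: "b t \<le> b s" if "s \<in> {\<sigma>0..\<sigma>}" "t \<in> {\<sigma>0..\<sigma>}" "s \<le> t" for s t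
  proof (rule ccontr)
    assume "\<not> b t \<le> b s"
    then have "Y (b t) < Y (b s)" using Y(2)[of "b s" "b t"] b(1)[OF that(1)] b(1)[OF that(2)] by auto
    then show False using b(2) that X(2)[of s t] \<sigma>0 by auto
  qed
  have bm: "b m = m"
    unfolding b_def Yi_def eq using injY m by (intro the_inv_into_f_f) auto
  have "continuous_on {\<sigma>0..\<sigma>} b"
    unfolding b_def Yi_def
    by (rule continuous_on_compose2[OF the_inv_into_Icc_continuous_on[OF Y(1) injY] continuous_on_subset[OF X(1)]])
      (use Xim(1) \<sigma>0 in auto)
  then have \<tau>_cont: "continuous_on {\<sigma>0..\<sigma>} (\<lambda>s. s - b s)" by (intro continuous_intros)
  \<comment> \<open>Strict even where \<open>X\<close> is constant, since \<open>b\<close> is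
    antitone and \<open>s\<close> itself increases.\<close>
  have \<tau>_mono: "s - b s < t - b t" if "s \<in> {\<sigma>0..\<sigma>}" "t \<in> {\<sigma>0..\<sigma>}" "s < t" for s t
    using b_anti[OF that(1,2)] that(3) by simp
  have inj\<tau>: "inj_on (\<lambda>s. s - b s) {\<sigma>0..\<sigma>}"
    by (rule linorder_inj_onI) (use \<tau>_mono in force)+
  define G where "G = the_inv_into {\<sigma>0..\<sigma>} (\<lambda>s. s - b s)"
  define w0 where "w0 = min (b \<sigma>0 - \<sigma>0) (\<sigma> - b \<sigma>)"
  have w0: "w0 > 0" using \<tau>_mono[of \<sigma>0 m] \<tau>_mono[of m \<sigma>] \<sigma>0 m bm by (auto simp: w0_def)
  have im\<tau>: "w \<in> (\<lambda>s. s - b s) ` {\<sigma>0..\<sigma>}" if "\<bar>w\<bar> < w0" for w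
    using IVT'[of "\<lambda>s. s - b s" \<sigma>0 w \<sigma>] \<tau>_cont that \<sigma>0 m by (force simp: w0_def)
  have G: "G w \<in> {\<sigma>0..\<sigma>}" "b (G w) = G w - w" if "\<bar>w\<bar> < w0" for w
  proof -
    show "G w \<in> {\<sigma>0..\<sigma>}"
      unfolding G_def by (rule the_inv_into_into[OF inj\<tau> im\<tau>[OF that]]) simp
    have "G w - b (G w) = w"
      unfolding G_def by (rule f_the_inv_into_f[OF inj\<tau> im\<tau>[OF that]])
    then show "b (G w) = G w - w" by simp
  qed
  show thesis
  proof (rule that[OF w0])
    show "continuous_on {-w0<..<w0} G"
      unfolding G_def
      by (rule continuous_on_subset[OF the_inv_into_Icc_continuous_on[OF \<tau>_cont inj\<tau>]]) (use im\<tau> in force)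
    have "the_inv_into {\<sigma>0..\<sigma>} (\<lambda>s. s - b s) (m - b m) = m"
      by (rule the_inv_into_f_f[OF inj\<tau>]) (use \<sigma>0 m in auto)
    then show "G 0 = m" by (simp add: G_def bm)
    show "G w \<in> {p<..\<sigma>}" if "\<bar>w\<bar> < w0" for w using G(1)[OF that] \<sigma>0 by auto
    show "G w - w \<in> {e..<q}" if "\<bar>w\<bar> < w0" for w using G[OF that] b(1)[of "G w"] by auto
    show "X (G w) = Y (G w - w)" if "\<bar>w\<bar> < w0" for w using G[OF that] b(2)[of "G w"] by auto
  qed
qed

section \<open>Two-sided local solutions of a scalar autonomous equation\<close>

text \<open>Separation of variables: a primitive \<open>H\<close> of \<open>1 / \<phi>\<close>
  measures travel time between levels, and its inverse solves the equation in both time directions.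
  The backward half is what forward well-posedness does not provide.\<close>

lemma autonomous_ode_local_solution_pos:
  fixes \<phi> :: "real \<Rightarrow> real"
  assumes cont: "continuous_on UNIV \<phi>" and pos: "\<phi> c > 0"
  shows "\<exists>\<epsilon>>0. \<exists>y. y 0 = c \<and> (\<forall>t. \<bar>t\<bar> < \<epsilon> \<longrightarrow> (y has_real_derivative \<phi> (y t)) (at t))"
proof -
  have "open {z. 0 < \<phi> z}" by (intro open_Collect_less continuous_intros cont)
  then obtain \<delta> where \<delta>: "\<delta> > 0" "cball c \<delta> \<subseteq> {z. 0 < \<phi> z}"
    using pos unfolding open_contains_cball by blast
  define a b where "a = c - \<delta>" and "b = c + \<delta>"
  have ab: "a < c" "c < b" using \<delta> by (auto simp: a_def b_def)
  have \<phi>pos: "0 < \<phi> z" if "z \<in> {a..b}" for z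
    using \<delta>(2) that by (auto simp: a_def b_def cball_eq_atLeastAtMost)
  define H where "H z = integral {a..z} (\<lambda>s. 1 / \<phi> s)" for z
  have "continuous_on {a..b} (\<lambda>s. 1 / \<phi> s)"
    by (intro continuous_intros continuous_on_subset[OF cont]) (use \<phi>pos in force)+
  then have H: "(H has_real_derivative 1 / \<phi> z) (at z within {a..b})" if "z \<in> {a..b}" for z
    unfolding H_def by (rule integral_has_real_derivative[OF _ that])
  then have H': "(H has_real_derivative 1 / \<phi> z) (at z)" if "z \<in> {a<..<b}" for z
    using that H[of z] at_within_Icc_at[of a z b] by auto
  have H_cont: "continuous_on {a..b} H" using H by (rule DERIV_continuous_on)
  have H_mono: "H s < H t" if "a \<le> s" "s < t" "t \<le> b" for s t
  proof (rule DERIV_pos_imp_increasing_open[OF that(2)])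
    show "\<exists>y. (H has_real_derivative y) (at z) \<and> y > 0" if "s < z" "z < t" for z
      using H'[of z] \<phi>pos[of z] that \<open>a \<le> s\<close> \<open>t \<le> b\<close> by (intro exI[of _ "1 / \<phi> z"]) auto
    show "continuous_on {s..t} H" by (rule continuous_on_subset[OF H_cont]) (use that in auto)
  qed
  have inj: "inj_on H {a..b}"
    by (rule linorder_inj_onI) (use H_mono in force)+
  define g where "g = the_inv_into {a..b} H"
  have im: "z \<in> H ` {a..b}" if "z \<in> {H a..H b}" for z
    using IVT'[of H a z b] H_cont that ab by force
  have g_cont: "continuous_on {H a..H b} g"
    unfolding g_def by (rule continuous_on_subset[OF the_inv_into_Icc_continuous_on[OF H_cont inj]]) (use im in blast)
  have Hg: "H (g z) = z" if "z \<in> {H a..H b}" for z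
    unfolding g_def by (rule f_the_inv_into_f[OF inj im[OF that]])
  have g_in: "g z \<in> {a..b}" if "z \<in> {H a..H b}" for z
    unfolding g_def by (rule the_inv_into_into[OF inj im[OF that]]) simp
  have g_der: "(g has_real_derivative \<phi> (g z)) (at z)" if z: "z \<in> {H a<..<H b}" for z
  proof -
    have "g z \<in> {a..b}" "H (g z) = z" using g_in Hg z by auto
    then have gz: "g z \<in> {a<..<b}" using z by (auto simp: less_le)
    have "(g has_real_derivative inverse (1 / \<phi> (g z))) (at z)"
    proof (rule DERIV_inverse_function[where f=H and g=g and x=z and a="H a" and b="H b", OF H'[OF gz]])
      show "1 / \<phi> (g z) \<noteq> 0" using \<phi>pos[of "g z"] gz by auto
      show "isCont g z"
        by (rule continuous_on_interior[OF g_cont]) (use z in auto)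
    qed (use z Hg in auto)
    then show ?thesis by simp
  qed
  define \<epsilon> where "\<epsilon> = min (H c - H a) (H b - H c)"
  have gc: "g (H c) = c" unfolding g_def by (rule the_inv_into_f_f[OF inj]) (use ab in auto)
  show ?thesis
  proof (intro exI[of _ \<epsilon>] conjI exI[of _ "\<lambda>t. g (H c + t)"] allI impI)
    show "\<epsilon> > 0" using H_mono[of a c] H_mono[of c b] ab by (auto simp: \<epsilon>_def)
    show "g (H c + 0) = c" using gc by simp
    show "((\<lambda>t. g (H c + t)) has_real_derivative \<phi> (g (H c + t))) (at t)" if "\<bar>t\<bar> < \<epsilon>" for t
      using DERIV_shift[of g "\<phi> (g (H c + t))" t "H c"] g_der[of "H c + t"] that
      by (auto simp: \<epsilon>_def add.commute abs_less_iff)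
  qed
qed

text \<open>Time reversal reduces a negative right-hand side to the positive one.\<close>

lemma autonomous_ode_local_solution:
  fixes \<phi> :: "real \<Rightarrow> real"
  assumes cont: "continuous_on UNIV \<phi>" and nz: "\<phi> c \<noteq> 0"
  shows "\<exists>\<epsilon>>0. \<exists>y. y 0 = c \<and> (\<forall>t. \<bar>t\<bar> < \<epsilon> \<longrightarrow> (y has_real_derivative \<phi> (y t)) (at t))"
proof (cases "\<phi> c > 0")
  case True
  then show ?thesis by (rule autonomous_ode_local_solution_pos[OF cont])
next
  case False
  then have "- \<phi> c > 0" using nz by simp
  then obtain \<epsilon> y where y: "\<epsilon> > 0" "y 0 = c" "\<And>t. \<bar>t\<bar> < \<epsilon> \<Longrightarrow> (y has_real_derivative - \<phi> (y t)) (at t)"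
    using autonomous_ode_local_solution_pos[of "\<lambda>z. - \<phi> z" c] cont continuous_on_minus by blast
  have "((\<lambda>t. y (- t)) has_real_derivative \<phi> (y (- t))) (at t)" if "\<bar>t\<bar> < \<epsilon>" for t
    using y(3)[of "- t"] that DERIV_mirror[of y "- \<phi> (y (- t))" t] by simp
  with y(1,2) show ?thesis by (intro exI[of _ \<epsilon>] conjI exI[of _ "\<lambda>t. y (- t)"]) auto
qed

lemma continuous_on_Icc_nearby:
  fixes g :: "real \<Rightarrow> real"
  assumes "continuous_on {a..b} g" "t \<in> {a..b}" "open W" "g t \<in> W"
  obtains d where "d > 0" "\<And>s. s \<in> {a..b} \<Longrightarrow> \<bar>s - t\<bar> \<le> d \<Longrightarrow> g s \<in> W"
proof -
  obtain \<epsilon> where \<epsilon>: "\<epsilon> > 0" "ball (g t) \<epsilon> \<subseteq> W"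
    using assms(3,4) unfolding open_contains_ball by blast
  obtain d where d: "d > 0" "\<And>s. s \<in> {a..b} \<Longrightarrow> dist s t < d \<Longrightarrow> dist (g s) (g t) < \<epsilon>"
    using assms(1,2) \<epsilon>(1) unfolding continuous_on_iff by metis
  show thesis
  proof (rule that[of "d / 2"])
    show "g s \<in> W" if "s \<in> {a..b}" "\<bar>s - t\<bar> \<le> d / 2" for s
      using d(2)[OF that(1)] that(2) d(1) \<epsilon>(2) by (force simp: dist_real_def dist_commute)
  qed (use d in simp)
qed

text \<open>The two sides are separate because the control may switch at \<open>t\<close>, leaving
  \<open>g\<close> without a derivative there.\<close>

lemma sided_derivatives_at_local_maximum:
  fixes g :: "real \<Rightarrow> real"
  assumes "d > 0" and max: "\<And>s. \<bar>s - t\<bar> < d \<Longrightarrow> g s \<le> g t" and pq: "p < t" "t < q"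
    and "(g has_real_derivative l) (at t within {p..t})" "(g has_real_derivative r) (at t within {t..q})"
  shows "0 \<le> l" "r \<le> 0"
proof -
  show "0 \<le> l"
  proof (rule ccontr)
    assume "\<not> 0 \<le> l"
    then obtain e where e: "e > 0" "\<And>h. 0 < h \<Longrightarrow> t - h \<in> {p..t} \<Longrightarrow> h < e \<Longrightarrow> g t < g (t - h)"
      using has_real_derivative_neg_dec_left[OF assms(5)] by auto
    define h where "h = min (min d e) (t - p) / 2"
    have "0 < h" "h < e" "h < d" "h < t - p" using e(1) assms(1) pq by (auto simp: h_def min_def)
    then show False using e(2)[of h] max[of "t - h"] by auto
  qed
  show "r \<le> 0"
  proof (rule ccontr)
    assume "\<not> r \<le> 0"
    then obtain e where e: "e > 0" "\<And>h. 0 < h \<Longrightarrow> t + h \<in> {t..q} \<Longrightarrow> h < e \<Longrightarrow> g t < g (t + h)"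
      using has_real_derivative_pos_inc_right[OF assms(6)] by auto
    define h where "h = min (min d e) (q - t) / 2"
    have "0 < h" "h < e" "h < d" "h < q - t" using e(1) assms(1) pq by (auto simp: h_def min_def)
    then show False using e(2)[of h] max[of "t + h"] by auto
  qed
qed

section \<open>Tents and plateaus\<close>

context control_system begin

text \<open>Time, distance and cost of a detour from the level \<^term>\<open>c\<close> to a nearby level and back are,
  to first order, in the ratio $1 : c : $ \<^term>\<open>marginal_cost c\<close>. Under (B4) the latter is minus the
  function of (B7).\<close>

definition marginal_cost :: "real \<Rightarrow> real" where
  "marginal_cost c = (h c False * f c True - h c True * f c False) / (f c True - f c False)"

text \<open>The factor \<open>s\<close> treats maxima and minima alike: \<open>s * \<xi>\<close>
  rises and \<open>s * \<eta>\<close> falls. The rise may be weak, which admits a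
  \<open>\<xi>\<close> resting at an equilibrium. The condition on the ends ensures that
  \<open>\<eta>\<close> has a matching level for all of \<open>\<xi>\<close> beyond
  \<open>m\<close>, even when \<open>e = m\<close>.\<close>

lemma adjustable_tent:
  assumes pmq: "0 \<le> p" "p < m" "m < q"
    and u_k: "\<And>t. t \<in> {p<..<m} \<Longrightarrow> u t = k" and u_l: "\<And>t. t \<in> {m<..<q} \<Longrightarrow> u t = l"
    and \<xi>: "arc k \<xi> {p..\<sigma>}" "m < \<sigma>" "\<And>t. t \<in> {p..m} \<Longrightarrow> \<xi> t = x t"
    and \<eta>: "arc l \<eta> {e..q}" "e \<le> m" "\<And>t. t \<in> {m..q} \<Longrightarrow> \<eta> t = x t"
    and s\<xi>: "\<And>t. t \<in> {p..\<sigma>} \<Longrightarrow> 0 \<le> s * f (\<xi> t) k"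
    and s\<eta>: "\<And>t. t \<in> {e..q} \<Longrightarrow> s * f (\<eta> t) l < 0"
    and top: "s * \<xi> \<sigma> \<le> s * \<eta> e"
  shows "adjustable u x p q (x m) (marginal_cost (x m))"
proof -
  note \<xi>_cont = arc_continuous_on[OF \<xi>(1)] and \<eta>_cont = arc_continuous_on[OF \<eta>(1)]
  have eqm: "\<xi> m = x m" "\<eta> m = x m" using \<xi>(3) \<eta>(3) pmq by auto
  have "0 \<le> s * f (x m) k" "s * f (x m) l < 0"
    using s\<xi>[of m] s\<eta>[of m] eqm pmq \<xi>(2) \<eta>(2) by auto
  then have ne: "f (x m) k \<noteq> f (x m) l" and s: "s \<noteq> 0" by auto
  then have kl: "l = (\<not> k)" by (cases k; cases l) auto
  obtain w0 G where w0: "w0 > 0" and G: "continuous_on {-w0<..<w0} G" "G 0 = m"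
    "\<And>w. \<bar>w\<bar> < w0 \<Longrightarrow> G w \<in> {p<..\<sigma>}" "\<And>w. \<bar>w\<bar> < w0 \<Longrightarrow> G w - w \<in> {e..<q}"
    "\<And>w. \<bar>w\<bar> < w0 \<Longrightarrow> s * \<xi> (G w) = s * \<eta> (G w - w)"
  proof (rule opposite_monotone_parametrization[of p \<sigma> "\<lambda>t. s * \<xi> t" e q "\<lambda>t. s * \<eta> t" m])
    show "continuous_on {p..\<sigma>} (\<lambda>t. s * \<xi> t)" "continuous_on {e..q} (\<lambda>t. s * \<eta> t)"
      by (intro continuous_intros \<xi>_cont \<eta>_cont)+
    show "s * \<xi> t1 \<le> s * \<xi> t2" if "p \<le> t1" "t1 \<le> t2" "t2 \<le> \<sigma>" for t1 t2
    proof (rule DERIV_nonneg_imp_increasing_open[OF that(2)])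
      show "\<exists>y. ((\<lambda>t. s * \<xi> t) has_real_derivative y) (at t) \<and> 0 \<le> y" if "t1 < t" "t < t2" for t
        using arc_interiorD[OF \<xi>(1), of t] s\<xi>[of t] that \<open>p \<le> t1\<close> \<open>t2 \<le> \<sigma>\<close>
        by (intro exI[of _ "s * f (\<xi> t) k"]) (auto intro: DERIV_cmult)
      show "continuous_on {t1..t2} (\<lambda>t. s * \<xi> t)"
        by (intro continuous_intros continuous_on_subset[OF \<xi>_cont]) (use that in auto)
    qed
    show "s * \<eta> t2 < s * \<eta> t1" if "e \<le> t1" "t1 < t2" "t2 \<le> q" for t1 t2
    proof (rule DERIV_neg_imp_decreasing_open[OF that(2)])
      show "\<exists>y. ((\<lambda>t. s * \<eta> t) has_real_derivative y) (at t) \<and> y < 0" if "t1 < t" "t < t2" for t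
        using arc_interiorD[OF \<eta>(1), of t] s\<eta>[of t] that \<open>e \<le> t1\<close> \<open>t2 \<le> q\<close>
        by (intro exI[of _ "s * f (\<eta> t) l"]) (auto intro: DERIV_cmult)
      show "continuous_on {t1..t2} (\<lambda>t. s * \<eta> t)"
        by (intro continuous_intros continuous_on_subset[OF \<eta>_cont]) (use that in auto)
    qed
  qed (use pmq \<xi>(2) \<eta>(2) top eqm in auto)
  have join: "\<xi> (G w) = \<eta> (G w - w)" if "\<bar>w\<bar> < w0" for w
    using G(5)[OF that] s by simp
  \<comment> \<open>Solution of \<open>f (x m) k * \<gamma> = f (x m) l * (\<gamma> - 1)\<close>,
    the linearization at 0 of \<open>\<xi> (G w) = \<eta> (G w - w)\<close>.\<close>
  define \<gamma> where "\<gamma> = - f (x m) l / (f (x m) k - f (x m) l)"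
  have "(\<xi> has_real_derivative f (x m) k) (at m within {p..\<sigma>})"
    using \<xi>(1,2) pmq eqm unfolding arc_def by (metis atLeastAtMost_iff less_imp_le)
  \<comment> \<open>\<open>G\<close> is not yet known to be differentiable, so the matching equation
    cannot be differentiated. Caratheodory slopes \<open>A\<close> and \<open>B\<close> turn it into
    an exact linear equation for the difference quotient of \<open>G\<close>.\<close>
  then obtain A where A: "\<And>z. \<xi> z - \<xi> m = A z * (z - m)" "continuous (at m within {p..\<sigma>}) A" "A m = f (x m) k"
    unfolding DERIV_caratheodory_within by blast
  have "(\<eta> has_real_derivative f (x m) l) (at m within {e..q})"
    using \<eta>(1,2) pmq eqm unfolding arc_def by (metis atLeastAtMost_iff less_imp_le)
  then obtain B where B: "\<And>z. \<eta> z - \<eta> m = B z * (z - m)" "continuous (at m within {e..q}) B" "B m = f (x m) l"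
    unfolding DERIV_caratheodory_within by blast
  have near: "\<forall>\<^sub>F w in at 0. \<bar>w\<bar> < w0"
    unfolding eventually_at using w0 by (intro exI[of _ w0]) (auto simp: dist_real_def)
  have "isCont G 0" using G(1) w0 by (simp add: continuous_on_eq_continuous_at)
  then have G0: "(G \<longlongrightarrow> m) (at 0)" using G(2) by (simp add: isCont_def)
  then have E0: "((\<lambda>w. G w - w) \<longlongrightarrow> m) (at 0)"
    by (auto intro!: tendsto_eq_intros)
  have "((\<lambda>w. A (G w)) \<longlongrightarrow> f (x m) k) (at 0)"
    unfolding A(3)[symmetric]
    by (rule continuous_within_tendsto_compose[OF A(2) _ G0])
      (use near in eventually_elim, use G(3) in force)
  moreover have "((\<lambda>w. B (G w - w)) \<longlongrightarrow> f (x m) l) (at 0)"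
    unfolding B(3)[symmetric]
    by (rule continuous_within_tendsto_compose[OF B(2) _ E0])
      (use near in eventually_elim, use G(4) in force)
  ultimately have lim: "((\<lambda>w. - B (G w - w) / (A (G w) - B (G w - w))) \<longlongrightarrow> \<gamma>) (at 0)"
    and diff: "((\<lambda>w. A (G w) - B (G w - w)) \<longlongrightarrow> f (x m) k - f (x m) l) (at 0)"
    unfolding \<gamma>_def using ne by (auto intro!: tendsto_intros)
  have ne': "\<forall>\<^sub>F w in at 0. A (G w) - B (G w - w) \<noteq> 0"
    by (rule tendsto_imp_eventually_ne[OF diff]) (use ne in simp)
  have "(G has_real_derivative \<gamma>) (at 0)"
    unfolding has_field_derivative_iff
  proof (rule Lim_transform_eventually[OF lim])
    have "\<forall>\<^sub>F w in at (0::real). w \<noteq> 0" by (simp add: eventually_at_filter)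
    with near ne' show "\<forall>\<^sub>F w in at 0. - B (G w - w) / (A (G w) - B (G w - w)) = (G w - G 0) / (w - 0)"
    proof eventually_elim
      case (elim w)
      have "A (G w) * (G w - m) = B (G w - w) * (G w - w - m)"
        using A(1)[of "G w"] B(1)[of "G w - w"] join[OF elim(1)] eqm by simp
      then have "(A (G w) - B (G w - w)) * (G w - m) = - B (G w - w) * w"
        by (simp add: algebra_simps)
      with elim G(2) show ?case by (simp add: field_simps)
    qed
  qed
  note G_der = this
  have "adjustable u x p q (x m) (\<gamma> * h (x m) k + (1 - \<gamma>) * h (x m) l)"
    by (rule adjustable_family[where \<xi>=\<xi> and \<eta>=\<eta> and \<sigma>=\<sigma> and e=e and ?w0.0=w0 and G=G])
      (fact pmq u_k u_l \<xi> \<eta> w0 G G_der join)+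
  \<comment> \<open>Exchanging the modes changes the sign of numerator and denominator, so the rate
    does not depend on which mode comes first.\<close>
  moreover have "\<gamma> * h (x m) k + (1 - \<gamma>) * h (x m) l = marginal_cost (x m)"
  proof -
    have "1 - \<gamma> = f (x m) k / (f (x m) k - f (x m) l)"
      using ne by (simp add: \<gamma>_def field_simps)
    then have "\<gamma> * h (x m) k + (1 - \<gamma>) * h (x m) l
        = (h (x m) l * f (x m) k - h (x m) k * f (x m) l) / (f (x m) k - f (x m) l)"
      by (simp add: \<gamma>_def diff_divide_distrib mult.commute)
    also have "\<dots> = marginal_cost (x m)"
    proof (cases k)
      case False
      then show ?thesis
        using minus_divide_divide[of "h (x m) False * f (x m) True - h (x m) True * f (x m) False" "f (x m) True - f (x m) False"]
        by (simp add: marginal_cost_def kl)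
    qed (simp add: marginal_cost_def kl)
    finally show ?thesis .
  qed
  ultimately show ?thesis by simp
qed

text \<open>At an equilibrium the marginal cost is the running cost, so lengthening or shortening a
  constant-speed phase obeys the same first-order law as moving the level of an extremum.\<close>

lemma adjustable_plateau:
  assumes pq: "0 \<le> p" "p < q" and u: "\<And>t. t \<in> {p<..<q} \<Longrightarrow> u t = k"
    and x: "\<And>t. t \<in> {p..q} \<Longrightarrow> x t = c" and c: "f c k = 0" "f c (\<not> k) \<noteq> 0"
  shows "adjustable u x p q c (marginal_cost c)"
proof -
  define m where "m = (p + q) / 2"
  have m: "p < m" "m < q" "m - p = q - m" using pq by (auto simp: m_def field_simps)
  have arc: "arc k (\<lambda>_. c) I" for I
    using c(1) by (auto simp: arc_def)
  \<comment> \<open>With \<open>G w = m + w\<close> the second half always starts at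
    \<open>m\<close> and the first half absorbs all of \<open>w\<close>, so \<gamma> is 1.\<close>
  have "adjustable u x p q (x m) (1 * h (x m) k + (1 - 1) * h (x m) k)"
    by (rule adjustable_family[where \<xi>="\<lambda>_. c" and \<eta>="\<lambda>_. c" and \<sigma>=q and e=p and ?w0.0="q - m" and G="\<lambda>w. m + w"])
      (use pq m u x arc in \<open>auto intro!: continuous_intros derivative_eq_intros simp: abs_less_iff\<close>)
  moreover have "x m = c" using x m by simp
  moreover have "marginal_cost c = h c k"
    using c by (cases k) (auto simp: marginal_cost_def)
  ultimately show ?thesis by simp
qed

end

section \<open>Attracting equilibria and the types of local extrema\<close>

locale attracted_control_system = control_system +
  fixes V :: "bool \<Rightarrow> real"
  assumes attraction: "\<And>x k. x \<noteq> V k \<Longrightarrow> (x - V k) * f x k < 0"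
    and equilibrium: "\<And>k. f (V k) k = 0"
    and f_less: "\<And>x. f x False < f x True"
begin

text \<open>The squared distance to \<open>V k\<close> is a Lyapunov function. It gives nothing
  backwards: an arc may arrive at \<open>V k\<close> in finite time.\<close>

lemma arc_stays_at_equilibrium:
  assumes "arc k y {a..b}" "y a = V k" "t \<in> {a..b}"
  shows "y t = V k"
proof -
  have "(y t - V k)\<^sup>2 \<le> (y a - V k)\<^sup>2"
  proof (rule DERIV_nonpos_imp_decreasing_open[of a t "\<lambda>r. (y r - V k)\<^sup>2"])
    show "a \<le> t" using assms by simp
    show "continuous_on {a..t} (\<lambda>r. (y r - V k)\<^sup>2)"
      by (intro continuous_intros continuous_on_subset[OF arc_continuous_on[OF assms(1)]]) (use assms in auto)
    show "\<exists>d. ((\<lambda>r. (y r - V k)\<^sup>2) has_real_derivative d) (at r) \<and> d \<le> 0" if "a < r" "r < t" for r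
    proof (intro exI conjI)
      have "(y has_real_derivative f (y r) k) (at r)"
        by (rule arc_interiorD[OF assms(1)]) (use that assms(3) in auto)
      then show "((\<lambda>r. (y r - V k)\<^sup>2) has_real_derivative 2 * ((y r - V k) * f (y r) k)) (at r)"
        by (auto intro!: derivative_eq_intros)
      have "(y r - V k) * f (y r) k \<le> 0"
        using attraction[of "y r" k] by (cases "y r = V k") (simp, rule less_imp_le)
      then show "2 * ((y r - V k) * f (y r) k) \<le> 0" by linarith
    qed
  qed
  then show ?thesis using assms(2) by simp
qed

text \<open>If the outgoing mode is at equilibrium at level \<open>x t\<close>, a plateau follows.
  If only the incoming mode is, then either a plateau precedes or the equilibrium is reached exactly
  at \<open>t\<close>. If neither is, both arcs are strictly monotone near \<open>t\<close> and can
  be prolonged. The last two cases are tents.\<close>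

lemma weak_local_extremum_adjustable:
  assumes tr: "trajectory T u x" and ext: "weak_local_extremum_on {0<..<T} x t" and r: "r > 0"
  shows "\<exists>a b. t - r < a \<and> a < b \<and> b < t + r \<and> 0 \<le> a \<and> b \<le> T \<and>
    adjustable u x a b (x t) (marginal_cost (x t))"
proof -
  have t: "0 < t" "t < T" using ext by (auto simp: weak_local_extremum_on_def)
  obtain p q k l where pq: "t - r < p" "0 < p" "p < t" "t < q" "q < t + r" "q < T"
    and u: "\<And>s. s \<in> {p<..<t} \<Longrightarrow> u s = k" "\<And>s. s \<in> {t<..<q} \<Longrightarrow> u s = l"
    and arcs: "arc k x {p..t}" "arc l x {t..q}"
    using that by (rule trajectory_one_sided_arcs[OF tr t r])
  \<comment> \<open>\<open>s = 1\<close> for a maximum and \<open>s = -1\<close> for a minimum, so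
    that \<open>s * x\<close> has a maximum in either case.\<close>
  obtain d s where d: "d > 0" "\<And>r. \<bar>r - t\<bar> < d \<Longrightarrow> s * x r \<le> s * x t" and s: "s = 1 \<or> s = (-1::real)"
  proof -
    have "at t within {0<..<T} = at t" using t by (intro at_within_open) auto
    then consider "\<forall>\<^sub>F r in at t. x r \<le> x t" | "\<forall>\<^sub>F r in at t. x t \<le> x r"
      using ext by (auto simp: weak_local_extremum_on_def)
    then show thesis
    proof cases
      case 1
      then obtain d where d: "d > 0" "\<And>r. r \<noteq> t \<Longrightarrow> dist r t < d \<Longrightarrow> x r \<le> x t"
        unfolding eventually_at by blast
      have "1 * x r \<le> 1 * x t" if "\<bar>r - t\<bar> < d" for r
        using d(2)[of r] that by (cases "r = t") (auto simp: dist_real_def)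
      then show ?thesis using that[of d 1] d(1) by blast
    next
      case 2
      then obtain d where d: "d > 0" "\<And>r. r \<noteq> t \<Longrightarrow> dist r t < d \<Longrightarrow> x t \<le> x r"
        unfolding eventually_at by blast
      have "- 1 * x r \<le> - 1 * x t" if "\<bar>r - t\<bar> < d" for r
        using d(2)[of r] that by (cases "r = t") (auto simp: dist_real_def)
      then show ?thesis using that[of d "-1"] d(1) by blast
    qed
  qed
  define c where "c = x t"
  have der: "(x has_real_derivative f c k) (at t within {p..t})" "(x has_real_derivative f c l) (at t within {t..q})"
    using arcs pq by (auto simp: arc_def c_def)
  have sk: "0 \<le> s * f c k" and sl: "s * f c l \<le> 0"
    using sided_derivatives_at_local_maximum[of d t "\<lambda>r. s * x r" p q "s * f c k" "s * f c l"] d pq der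
    by (auto intro: DERIV_cmult)
  have other: "f c (\<not> b) \<noteq> 0" if "f c b = 0" for b
    using f_less[of c] that by (cases b) auto
  have equil: "c = V b" if "f c b = 0" for b
    using attraction[of c b] that by force
  have xc: "continuous_on {p..t} x" "continuous_on {t..q} x" using arcs by (auto intro: arc_continuous_on)
  show ?thesis
  proof (cases "f c l = 0")
    case True
    then have "x r = c" if "r \<in> {t..q}" for r
      using arc_stays_at_equilibrium[OF arcs(2) _ that] equil by (simp add: c_def)
    then have "adjustable u x t q c (marginal_cost c)"
      using t pq u(2) True other by (intro adjustable_plateau) auto
    then show ?thesis using t pq r unfolding c_def by (intro exI[of _ t] exI[of _ q]) auto
  next
    case fl: False
    then have sl': "s * f c l < 0" using sl s by auto
    show ?thesis
    proof (cases "f c k = 0")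
      case fk: True
      note ck = equil[OF fk]
      show ?thesis
      proof (cases "\<exists>r\<in>{p..<t}. x r = V k")
        case True
        then obtain r0 where r0: "r0 \<in> {p..<t}" "x r0 = V k" by blast
        have "x r = c" if "r \<in> {r0..t}" for r
          using arc_stays_at_equilibrium[OF arc_subset[OF arcs(1)] r0(2) that] r0 ck by auto
        then have "adjustable u x r0 t c (marginal_cost c)"
          using t pq u(1) fk other r0(1) by (intro adjustable_plateau) auto
        then show ?thesis using t pq r0 r unfolding c_def by (intro exI[of _ r0] exI[of _ t]) auto
      next
        case False
        \<comment> \<open>Mode \<open>k\<close> reaches its equilibrium exactly at \<open>t\<close>.
          Its prolongation rests at that level, so \<open>\<eta>\<close> can start at
          \<open>t\<close> without a backward prolongation: gained time is spent at rest, lost time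
          moves the turning level back. The length 1 of the rest is arbitrary.\<close>
        have "open {z. s * f z l < 0}" by (intro open_Collect_less continuous_intros cont_f)
        then obtain e where e: "e > 0" "\<And>r. r \<in> {t..q} \<Longrightarrow> \<bar>r - t\<bar> \<le> e \<Longrightarrow> s * f (x r) l < 0"
          using continuous_on_Icc_nearby[OF xc(2), of t "{z. s * f z l < 0}"] sl' pq c_def by auto
        define p' q' where "p' = max p (t - d / 2)" and "q' = min q (t + e)"
        have p'q': "p \<le> p'" "t - d < p'" "p' < t" "t < q'" "q' \<le> q" "q' \<le> t + e"
          using pq d(1) e(1) by (auto simp: p'_def q'_def)
        let ?\<xi> = "\<lambda>r. if r \<le> t then x r else V k"
        have "arc k ?\<xi> {p'..t + 1}"
        proof (rule arc_join)
          show "arc k x {p'..t}" by (rule arc_subset[OF arcs(1)]) (use p'q' in auto)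
          show "arc k (\<lambda>_. V k) {t..t + 1}" by (simp add: arc_def equilibrium)
        qed (use ck c_def p'q' in auto)
        moreover have "0 \<le> s * f (?\<xi> r) k" if r: "r \<in> {p'..t + 1}" for r
        proof (cases "r < t")
          case True
          have "x r \<noteq> V k" using False True r p'q' by auto
          moreover have "s * x r \<le> s * V k" using d(2)[of r] r True p'q' ck c_def by auto
          ultimately show ?thesis using s attraction[of "x r" k] True by (auto simp: mult_less_0_iff)
        next
          case False
          then show ?thesis using ck c_def by (cases "r = t") (auto simp: equilibrium)
        qed
        moreover have "arc l x {t..q'}" by (rule arc_subset[OF arcs(2)]) (use p'q' in auto)
        moreover have "s * f (x r) l < 0" if "r \<in> {t..q'}" for r
          using e(2)[of r] that p'q' by auto
        ultimately have "adjustable u x p' q' (x t) (marginal_cost (x t))"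
        proof (intro adjustable_tent[where \<xi>="?\<xi>" and \<eta>=x and k=k and l=l and \<sigma>="t + 1" and e=t and s=s])
          show "u r = k" if "r \<in> {p'<..<t}" for r using u(1)[of r] that p'q' by simp
          show "u r = l" if "r \<in> {t<..<q'}" for r using u(2)[of r] that p'q' by simp
          show "s * ?\<xi> (t + 1) \<le> s * x t" using ck c_def by simp
        qed (use p'q' pq in simp_all)
        then show ?thesis using p'q' pq by (intro exI[of _ p'] exI[of _ q']) auto
      qed
    next
      case fk: False
      then have sk': "0 < s * f c k" using sk s by (auto simp: less_le)
      \<comment> \<open>Levels at which mode \<open>k\<close> strictly raises and mode
        \<open>l\<close> strictly lowers \<open>s\<close> times the speed; all arcs and
        prolongations are kept inside \<open>W\<close>.\<close>
      define W where "W = {z. 0 < s * f z k} \<inter> {z. s * f z l < 0}"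
      have W: "open W" "c \<in> W"
        unfolding W_def using sk' sl' by (auto intro!: open_Int open_Collect_less continuous_intros cont_f)
      \<comment> \<open>Used forwards to prolong the incoming arc and backwards to prolong the
        outgoing one.\<close>
      have arc_through: "\<exists>\<epsilon>>0. \<exists>y. y 0 = c \<and> arc b y {-\<epsilon>..\<epsilon>} \<and> y ` {-\<epsilon>..\<epsilon>} \<subseteq> W" if nz: "f c b \<noteq> 0" for b
      proof -
        obtain \<epsilon> y where y: "\<epsilon> > 0" "y 0 = c" "\<And>t. \<bar>t\<bar> < \<epsilon> \<Longrightarrow> (y has_real_derivative f (y t) b) (at t)"
          using autonomous_ode_local_solution[OF cont_f nz] by blast
        have arc: "arc b y {-(\<epsilon>/2)..\<epsilon>/2}"
          unfolding arc_def using y(1) by (auto intro!: has_field_derivative_at_within y(3))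
        obtain e where e: "e > 0" "\<And>r. r \<in> {-(\<epsilon>/2)..\<epsilon>/2} \<Longrightarrow> \<bar>r - 0\<bar> \<le> e \<Longrightarrow> y r \<in> W"
          using continuous_on_Icc_nearby[OF arc_continuous_on[OF arc] _ W(1), of 0] y(1,2) W(2) by auto
        define \<delta> where "\<delta> = min (\<epsilon>/2) e"
        have "\<delta> > 0" "{-\<delta>..\<delta>} \<subseteq> {-(\<epsilon>/2)..\<epsilon>/2}" "\<And>r. r \<in> {-\<delta>..\<delta>} \<Longrightarrow> y r \<in> W"
          using y(1) e by (auto simp: \<delta>_def abs_le_iff)
        then show ?thesis using y(2) arc_subset[OF arc] by (intro exI[of _ \<delta>] conjI exI[of _ y]) auto
      qed
      obtain \<epsilon>1 y1 where y1: "\<epsilon>1 > 0" "y1 0 = c" "arc k y1 {-\<epsilon>1..\<epsilon>1}" "y1 ` {-\<epsilon>1..\<epsilon>1} \<subseteq> W"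
        using arc_through[OF fk] by blast
      obtain \<epsilon>2 y2 where y2: "\<epsilon>2 > 0" "y2 0 = c" "arc l y2 {-\<epsilon>2..\<epsilon>2}" "y2 ` {-\<epsilon>2..\<epsilon>2} \<subseteq> W"
        using arc_through[OF fl] by blast
      have y1W: "y1 r \<in> W" if "r \<in> {-\<epsilon>1..\<epsilon>1}" for r using y1(4) that by blast
      have y2W: "y2 r \<in> W" if "r \<in> {-\<epsilon>2..\<epsilon>2}" for r using y2(4) that by blast
      obtain e1 where e1: "e1 > 0" "\<And>r. r \<in> {p..t} \<Longrightarrow> \<bar>r - t\<bar> \<le> e1 \<Longrightarrow> x r \<in> W"
        using continuous_on_Icc_nearby[OF xc(1) _ W(1), of t] W(2) pq c_def by auto
      obtain e2 where e2: "e2 > 0" "\<And>r. r \<in> {t..q} \<Longrightarrow> \<bar>r - t\<bar> \<le> e2 \<Longrightarrow> x r \<in> W"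
        using continuous_on_Icc_nearby[OF xc(2) _ W(1), of t] W(2) pq c_def by auto
      define p' q' where "p' = max p (t - e1)" and "q' = min q (t + e2)"
      have p'q': "p \<le> p'" "t - e1 \<le> p'" "p' < t" "t < q'" "q' \<le> q" "q' \<le> t + e2"
        using pq e1(1) e2(1) by (auto simp: p'_def q'_def)
      \<comment> \<open>The backward prolongation of the outgoing arc starts strictly beyond level
        \<open>c\<close>, which leaves room for a short forward prolongation
        \<open>\<epsilon>3\<close> of the incoming arc that does not pass it.\<close>
      have "s * y2 0 < s * y2 (-\<epsilon>2)"
      proof (rule DERIV_neg_imp_decreasing_open[of "- \<epsilon>2" 0 "\<lambda>r. s * y2 r"])
        show "- \<epsilon>2 < 0" using y2(1) by simp
        show "\<exists>y. ((\<lambda>r. s * y2 r) has_real_derivative y) (at r) \<and> y < 0" if "-\<epsilon>2 < r" "r < 0" for r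
          using arc_interiorD[OF y2(3), of r] y2W[of r] that
          by (intro exI[of _ "s * f (y2 r) l"]) (auto intro: DERIV_cmult simp: W_def)
        show "continuous_on {-\<epsilon>2..0} (\<lambda>r. s * y2 r)"
          by (intro continuous_intros continuous_on_subset[OF arc_continuous_on[OF y2(3)]]) (use y2(1) in auto)
      qed
      moreover have "open {z. s * z < s * y2 (-\<epsilon>2)}" by (intro open_Collect_less continuous_intros)
      ultimately obtain e3 where e3: "e3 > 0"
        "\<And>r. r \<in> {-\<epsilon>1..\<epsilon>1} \<Longrightarrow> \<bar>r - 0\<bar> \<le> e3 \<Longrightarrow> s * y1 r < s * y2 (-\<epsilon>2)"
        using continuous_on_Icc_nearby[OF arc_continuous_on[OF y1(3)], of 0 "{z. s * z < s * y2 (-\<epsilon>2)}"] y1(1,2) y2(2)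
        by auto
      define \<epsilon>3 where "\<epsilon>3 = min \<epsilon>1 e3"
      have \<epsilon>3: "0 < \<epsilon>3" "\<epsilon>3 \<le> \<epsilon>1" "s * y1 \<epsilon>3 < s * y2 (-\<epsilon>2)"
        using y1(1) e3 by (auto simp: \<epsilon>3_def)
      let ?\<xi> = "\<lambda>r. if r \<le> t then x r else y1 (r - t)"
      let ?\<eta> = "\<lambda>r. if r \<le> t then y2 (r - t) else x r"
      have "arc k ?\<xi> {p'..t + \<epsilon>3}"
      proof (rule arc_join)
        show "arc k x {p'..t}" by (rule arc_subset[OF arcs(1)]) (use p'q' in auto)
        have "arc k (\<lambda>r. y1 (r - t)) {-\<epsilon>1 + t..\<epsilon>1 + t}" by (rule arc_shift[OF y1(3)])
        then show "arc k (\<lambda>r. y1 (r - t)) {t..t + \<epsilon>3}" by (rule arc_subset) (use \<epsilon>3 in auto)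
      qed (use y1(2) c_def p'q' \<epsilon>3 in auto)
      moreover have "arc l ?\<eta> {t - \<epsilon>2..q'}"
      proof (rule arc_join)
        show "arc l x {t..q'}" by (rule arc_subset[OF arcs(2)]) (use p'q' in auto)
        have "arc l (\<lambda>r. y2 (r - t)) {-\<epsilon>2 + t..\<epsilon>2 + t}" by (rule arc_shift[OF y2(3)])
        then show "arc l (\<lambda>r. y2 (r - t)) {t - \<epsilon>2..t}" by (rule arc_subset) (use y2(1) in auto)
      qed (use y2(1,2) c_def p'q' in auto)
      moreover have \<xi>W: "?\<xi> r \<in> W" if "r \<in> {p'..t + \<epsilon>3}" for r
        using that e1(2)[of r] y1W[of "r - t"] \<epsilon>3 p'q' by auto
      moreover have \<eta>W: "?\<eta> r \<in> W" if "r \<in> {t - \<epsilon>2..q'}" for r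
        using that e2(2)[of r] y2W[of "r - t"] y2(1) p'q' by auto
      ultimately have "adjustable u x p' q' (x t) (marginal_cost (x t))"
      proof (intro adjustable_tent[where \<xi>="?\<xi>" and \<eta>="?\<eta>" and k=k and l=l and \<sigma>="t + \<epsilon>3" and e="t - \<epsilon>2" and s=s])
        show "u r = k" if "r \<in> {p'<..<t}" for r using u(1)[of r] that p'q' by simp
        show "u r = l" if "r \<in> {t<..<q'}" for r using u(2)[of r] that p'q' by simp
        show "0 \<le> s * f (?\<xi> r) k" if "r \<in> {p'..t + \<epsilon>3}" for r
          using \<xi>W[OF that] unfolding W_def by (blast intro: less_imp_le)
        show "s * f (?\<eta> r) l < 0" if "r \<in> {t - \<epsilon>2..q'}" for r
          using \<eta>W[OF that] unfolding W_def by blast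
        show "s * ?\<xi> (t + \<epsilon>3) \<le> s * ?\<eta> (t - \<epsilon>2)" using \<epsilon>3 y2(1) by simp
        show "?\<eta> r = x r" if "r \<in> {t..q'}" for r
          using that y2(2) c_def by (cases "r = t") simp_all
      qed (use p'q' pq \<epsilon>3 y2(1) in simp_all)
      then show ?thesis using p'q' pq by (intro exI[of _ p'] exI[of _ q']) auto
    qed
  qed
qed

end

section \<open>Three adjustable windows\<close>

lemma linear_approximation_at_0:
  fixes D :: "real \<Rightarrow> real"
  assumes "(D has_real_derivative c) (at 0)" "D 0 = 0" "\<kappa> > 0"
  shows "\<exists>\<delta>>0. \<forall>w. \<bar>w\<bar> < \<delta> \<longrightarrow> \<bar>D w - c * w\<bar> \<le> \<kappa> * \<bar>w\<bar>"
  using assms unfolding has_field_derivative_def has_derivative_at_alt by auto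

text \<open>The direction $(c_1 - c_2, c_2 - c_0, c_0 - c_1)$ satisfies both linearized constraints; a
  correction of size $\<beta> t$ along $(1,-1,0)$, found by the intermediate value theorem, satisfies the
  second one exactly.\<close>

lemma lagrange_three:
  fixes D J :: "nat \<Rightarrow> real \<Rightarrow> real" and c \<rho> :: "nat \<Rightarrow> real"
  assumes w0: "w0 > 0"
    and cont: "\<And>i. i < 3 \<Longrightarrow> continuous_on {-w0<..<w0} (D i)"
    and zero: "\<And>i. i < 3 \<Longrightarrow> D i 0 = 0" "\<And>i. i < 3 \<Longrightarrow> J i 0 = 0"
    and der: "\<And>i. i < 3 \<Longrightarrow> (D i has_real_derivative c i) (at 0)"
      "\<And>i. i < 3 \<Longrightarrow> (J i has_real_derivative \<rho> i) (at 0)"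
    and distinct: "c 0 \<noteq> c 1"
    and minimal: "\<And>w0' w1 w2. \<lbrakk>\<bar>w0'\<bar> < w0; \<bar>w1\<bar> < w0; \<bar>w2\<bar> < w0; w0' + w1 + w2 = 0;
        D 0 w0' + D 1 w1 + D 2 w2 = 0\<rbrakk> \<Longrightarrow> 0 \<le> J 0 w0' + J 1 w1 + J 2 w2"
  shows "\<rho> 0 * (c 1 - c 2) + \<rho> 1 * (c 2 - c 0) + \<rho> 2 * (c 0 - c 1) = 0"
proof (rule ccontr)
  define K where "K = \<rho> 0 * (c 1 - c 2) + \<rho> 1 * (c 2 - c 0) + \<rho> 2 * (c 0 - c 1)"
  assume "\<not> ?thesis"
  then have K: "\<bar>K\<bar> > 0" by (simp add: K_def)
  \<comment> \<open>\<open>t * M\<close> will bound all three displacements; the summand 1 pays for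
    the correction, which is at most \<open>\<beta> * t \<le> t\<close>.\<close>
  define M where "M = \<bar>c 1 - c 2\<bar> + \<bar>c 2 - c 0\<bar> + \<bar>c 0 - c 1\<bar> + 1"
  \<comment> \<open>The sign makes the linear part of the cost change equal to
    \<open>- t * \<bar>K\<bar>\<close>.\<close>
  define s where "s = - sgn K"
  have s: "\<bar>s\<bar> = 1" "s * K = - \<bar>K\<bar>" using K by (auto simp: s_def sgn_if)
  \<comment> \<open>Small enough that the correction costs at most
    \<open>t * \<bar>K\<bar> / 4\<close>.\<close>
  define \<beta> where "\<beta> = min 1 (\<bar>K\<bar> / (4 * (\<bar>\<rho> 0 - \<rho> 1\<bar> + 1)))"
  have pos: "0 < 4 * (\<bar>\<rho> 0 - \<rho> 1\<bar> + 1)" by (intro mult_pos_pos add_nonneg_pos) auto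
  have "\<beta> * (4 * (\<bar>\<rho> 0 - \<rho> 1\<bar> + 1)) \<le> \<bar>K\<bar> / (4 * (\<bar>\<rho> 0 - \<rho> 1\<bar> + 1)) * (4 * (\<bar>\<rho> 0 - \<rho> 1\<bar> + 1))"
    by (rule mult_right_mono) (auto simp: \<beta>_def)
  also have "\<dots> = \<bar>K\<bar>" by (rule nonzero_eq_divide_eq[THEN iffD1, OF less_imp_neq[OF pos, symmetric] refl])
  finally have \<beta>K: "\<beta> * (4 * (\<bar>\<rho> 0 - \<rho> 1\<bar> + 1)) \<le> \<bar>K\<bar>" .
  have \<beta>: "\<beta> > 0" "\<beta> \<le> 1"
    unfolding \<beta>_def using divide_pos_pos[OF K pos] by (simp_all only: min_less_iff_conj zero_less_one simp_thms min.cobounded1)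
  have \<beta>K': "\<beta> * \<bar>\<rho> 0 - \<rho> 1\<bar> \<le> \<bar>K\<bar> / 4" using \<beta>K \<beta> by (simp add: algebra_simps)
  \<comment> \<open>Three linearization errors of at most \<open>\<kappa> * (t * M)\<close> each
    must stay below both the effect \<open>\<bar>c 0 - c 1\<bar> * \<beta> * t\<close> of the
    largest correction on the distance and \<open>t * \<bar>K\<bar> / 2\<close> in the cost. The
    cost change is then at most \<open>- t * \<bar>K\<bar> / 4\<close>.\<close>
  define \<kappa> where "\<kappa> = min (\<bar>c 0 - c 1\<bar> * \<beta>) (\<bar>K\<bar> / 2) / (3 * M)"
  have M: "M \<ge> 1" by (simp add: M_def)
  have \<kappa>: "\<kappa> > 0" "3 * \<kappa> * M \<le> \<bar>c 0 - c 1\<bar> * \<beta>" "3 * \<kappa> * M \<le> \<bar>K\<bar> / 2"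
    using distinct \<beta> K M by (auto simp: \<kappa>_def)
  have "\<exists>\<delta>>0. \<forall>w. \<bar>w\<bar> < \<delta> \<longrightarrow> \<bar>D i w - c i * w\<bar> \<le> \<kappa> * \<bar>w\<bar> \<and> \<bar>J i w - \<rho> i * w\<bar> \<le> \<kappa> * \<bar>w\<bar>" if i: "i < 3" for i
  proof -
    obtain d1 where "d1 > 0" "\<And>w. \<bar>w\<bar> < d1 \<Longrightarrow> \<bar>D i w - c i * w\<bar> \<le> \<kappa> * \<bar>w\<bar>"
      using linear_approximation_at_0[OF der(1)[OF i] zero(1)[OF i] \<kappa>(1)] by blast
    moreover obtain d2 where "d2 > 0" "\<And>w. \<bar>w\<bar> < d2 \<Longrightarrow> \<bar>J i w - \<rho> i * w\<bar> \<le> \<kappa> * \<bar>w\<bar>"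
      using linear_approximation_at_0[OF der(2)[OF i] zero(2)[OF i] \<kappa>(1)] by blast
    ultimately show ?thesis by (intro exI[of _ "min d1 d2"]) auto
  qed
  then obtain \<delta>' where \<delta>': "\<And>i. i < 3 \<Longrightarrow> \<delta>' i > 0"
    "\<And>i w. i < 3 \<Longrightarrow> \<bar>w\<bar> < \<delta>' i \<Longrightarrow> \<bar>D i w - c i * w\<bar> \<le> \<kappa> * \<bar>w\<bar>"
    "\<And>i w. i < 3 \<Longrightarrow> \<bar>w\<bar> < \<delta>' i \<Longrightarrow> \<bar>J i w - \<rho> i * w\<bar> \<le> \<kappa> * \<bar>w\<bar>"
    by metis
  define \<delta> where "\<delta> = min w0 (min (\<delta>' 0) (min (\<delta>' 1) (\<delta>' 2)))"
  have \<delta>: "\<delta> > 0" "\<delta> \<le> w0" "\<delta> \<le> \<delta>' 0" "\<delta> \<le> \<delta>' 1" "\<delta> \<le> \<delta>' 2"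
    using w0 \<delta>'(1)[of 0] \<delta>'(1)[of 1] \<delta>'(1)[of 2] by (auto simp: \<delta>_def)
  define t where "t = \<delta> / (2 * M)"
  have t: "t > 0" "t * M < \<delta>" using \<delta> M by (auto simp: t_def)
  define a where "a \<eta> = s * t * (c 1 - c 2) + \<eta>" for \<eta>
  define b where "b \<eta> = s * t * (c 2 - c 0) - \<eta>" for \<eta>
  define d where "d = s * t * (c 0 - c 1)"
  have st: "\<bar>s * t * v\<bar> = t * \<bar>v\<bar>" for v using s(1) t(1) by (simp add: abs_mult)
  define A1 A2 A3 where "A1 = t * \<bar>c 1 - c 2\<bar>" and "A2 = t * \<bar>c 2 - c 0\<bar>" and "A3 = t * \<bar>c 0 - c 1\<bar>"
  have tM: "t * M = A1 + A2 + A3 + t"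
    by (simp add: M_def A1_def A2_def A3_def algebra_simps)
  have A: "0 \<le> A1" "0 \<le> A2" "0 \<le> A3" using t(1) by (auto simp: A1_def A2_def A3_def)
  have small: "\<bar>a \<eta>\<bar> \<le> t * M" "\<bar>b \<eta>\<bar> \<le> t * M" "\<bar>d\<bar> \<le> t * M" if \<eta>: "\<bar>\<eta>\<bar> \<le> \<beta> * t" for \<eta>
  proof -
    have \<beta>t: "\<beta> * t \<le> t" using \<beta> t by simp
    have "\<bar>a \<eta>\<bar> \<le> A1 + \<bar>\<eta>\<bar>"
      unfolding a_def A1_def by (rule order_trans[OF abs_triangle_ineq]) (simp add: st)
    then show "\<bar>a \<eta>\<bar> \<le> t * M" unfolding tM using A \<eta> \<beta>t by linarith
    have "\<bar>b \<eta>\<bar> \<le> A2 + \<bar>\<eta>\<bar>"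
      unfolding b_def A2_def by (rule order_trans[OF abs_triangle_ineq4]) (simp add: st)
    then show "\<bar>b \<eta>\<bar> \<le> t * M" unfolding tM using A \<eta> \<beta>t by linarith
    have "\<bar>d\<bar> = A3" unfolding d_def A3_def by (rule st)
    then show "\<bar>d\<bar> \<le> t * M" unfolding tM using A t(1) by linarith
  qed
  define \<phi> where "\<phi> \<eta> = D 0 (a \<eta>) + D 1 (b \<eta>) + D 2 d" for \<eta>
  have \<kappa>small: "\<kappa> * \<bar>w\<bar> \<le> \<kappa> * (t * M)" if "\<bar>w\<bar> \<le> t * M" for w
    using that \<kappa>(1) by simp
  have \<delta>_le: "t * M < \<delta>' i" if "i < 3" for i
  proof -
    from that consider "i = 0" | "i = 1" | "i = 2" by linarith
    then show ?thesis by cases (use \<delta> t(2) in simp_all)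
  qed
  have approx: "\<bar>D i w - c i * w\<bar> \<le> \<kappa> * (t * M)" "\<bar>J i w - \<rho> i * w\<bar> \<le> \<kappa> * (t * M)"
    if "i < 3" "\<bar>w\<bar> \<le> t * M" for i w
    using \<delta>'(2,3)[OF that(1) le_less_trans[OF that(2) \<delta>_le[OF that(1)]]] \<kappa>small[OF that(2)]
    by (blast intro: order_trans)+
  have abs3: "\<bar>X + Y + Z\<bar> \<le> 3 * B" if "\<bar>X\<bar> \<le> B" "\<bar>Y\<bar> \<le> B" "\<bar>Z\<bar> \<le> B" for X Y Z B :: real
    using that by linarith
  have \<phi>: "\<bar>\<phi> \<eta> - (c 0 - c 1) * \<eta>\<bar> \<le> 3 * \<kappa> * M * t" if \<eta>: "\<bar>\<eta>\<bar> \<le> \<beta> * t" for \<eta>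
  proof -
    have "\<bar>(D 0 (a \<eta>) - c 0 * a \<eta>) + (D 1 (b \<eta>) - c 1 * b \<eta>) + (D 2 d - c 2 * d)\<bar> \<le> 3 * (\<kappa> * (t * M))"
      by (intro abs3 approx(1) small[OF \<eta>]) simp_all
    moreover have "(D 0 (a \<eta>) - c 0 * a \<eta>) + (D 1 (b \<eta>) - c 1 * b \<eta>) + (D 2 d - c 2 * d) = \<phi> \<eta> - (c 0 - c 1) * \<eta>"
      unfolding \<phi>_def by (simp add: a_def b_def d_def algebra_simps)
    ultimately show ?thesis by (simp add: mult_ac)
  qed
  have \<phi>_cont: "continuous_on {- (\<beta> * t)..\<beta> * t} \<phi>"
    unfolding \<phi>_def
  proof (intro continuous_intros)
    have range: "a \<eta> \<in> {-w0<..<w0}" "b \<eta> \<in> {-w0<..<w0}" if "\<eta> \<in> {- (\<beta> * t)..\<beta> * t}" for \<eta>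
    proof -
      have "\<bar>\<eta>\<bar> \<le> \<beta> * t" using that by auto
      from small(1,2)[OF this] t \<delta> show "a \<eta> \<in> {-w0<..<w0}" "b \<eta> \<in> {-w0<..<w0}" by auto
    qed
    have "continuous_on {- (\<beta> * t)..\<beta> * t} a" "continuous_on {- (\<beta> * t)..\<beta> * t} b"
      unfolding a_def b_def by (intro continuous_intros)+
    then show "continuous_on {- (\<beta> * t)..\<beta> * t} (\<lambda>\<eta>. D 0 (a \<eta>))"
        "continuous_on {- (\<beta> * t)..\<beta> * t} (\<lambda>\<eta>. D 1 (b \<eta>))"
      using range by (auto simp del: One_nat_def intro!: continuous_on_compose2[OF cont[of 0]] continuous_on_compose2[OF cont[of 1]])
  qed
  have \<beta>t: "0 \<le> \<beta> * t" "\<bar>\<beta> * t\<bar> \<le> \<beta> * t" "\<bar>- (\<beta> * t)\<bar> \<le> \<beta> * t" using \<beta> t by auto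
  have bound: "3 * \<kappa> * M * t \<le> \<bar>c 0 - c 1\<bar> * (\<beta> * t)"
    using mult_right_mono[OF \<kappa>(2), of t] t by (simp add: mult.assoc)
  \<comment> \<open>Linear prediction for \<open>\<phi>\<close> at the largest correction. The error
    is at most \<open>\<bar>z\<bar>\<close>, so \<open>\<phi>\<close> takes weakly opposite signs at
    the two ends.\<close>
  define z where "z = (c 0 - c 1) * (\<beta> * t)"
  have "\<bar>z\<bar> = \<bar>c 0 - c 1\<bar> * (\<beta> * t)" 
    unfolding z_def abs_mult[of "c 0 - c 1"] abs_of_nonneg[OF \<beta>t(1)] ..
  then have ends: "\<bar>\<phi> (\<beta> * t) - z\<bar> \<le> \<bar>z\<bar>" "\<bar>\<phi> (- (\<beta> * t)) + z\<bar> \<le> \<bar>z\<bar>"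
    using \<phi>[OF \<beta>t(2)] \<phi>[OF \<beta>t(3)] bound by (simp_all add: z_def)
  have "\<exists>\<eta>. \<bar>\<eta>\<bar> \<le> \<beta> * t \<and> \<phi> \<eta> = 0"
  proof (cases "0 \<le> z")
    case True
    then have "\<phi> (- (\<beta> * t)) \<le> 0" "0 \<le> \<phi> (\<beta> * t)" using ends by linarith+
    then obtain \<eta> where "- (\<beta> * t) \<le> \<eta>" "\<eta> \<le> \<beta> * t" "\<phi> \<eta> = 0"
      using IVT'[of \<phi> "- (\<beta> * t)" 0 "\<beta> * t"] \<phi>_cont \<beta>t(1) by auto
    then show ?thesis by (intro exI[of _ \<eta>]) (simp add: abs_le_iff)
  next
    case False
    then have "\<phi> (\<beta> * t) \<le> 0" "0 \<le> \<phi> (- (\<beta> * t))" using ends by linarith+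
    then obtain \<eta> where "- (\<beta> * t) \<le> \<eta>" "\<eta> \<le> \<beta> * t" "\<phi> \<eta> = 0"
      using IVT2'[of \<phi> "\<beta> * t" 0 "- (\<beta> * t)"] \<phi>_cont \<beta>t(1) by auto
    then show ?thesis by (intro exI[of _ \<eta>]) (simp add: abs_le_iff)
  qed
  then obtain \<eta> where \<eta>: "\<bar>\<eta>\<bar> \<le> \<beta> * t" "\<phi> \<eta> = 0" by blast
  have "0 \<le> J 0 (a \<eta>) + J 1 (b \<eta>) + J 2 d"
  proof (rule minimal)
    show "\<bar>a \<eta>\<bar> < w0" "\<bar>b \<eta>\<bar> < w0" "\<bar>d\<bar> < w0" using small[OF \<eta>(1)] t \<delta> by auto
    show "a \<eta> + b \<eta> + d = 0" by (simp add: a_def b_def d_def algebra_simps)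
    show "D 0 (a \<eta>) + D 1 (b \<eta>) + D 2 d = 0" using \<eta>(2) by (simp add: \<phi>_def)
  qed
  moreover have "\<bar>(J 0 (a \<eta>) - \<rho> 0 * a \<eta>) + (J 1 (b \<eta>) - \<rho> 1 * b \<eta>) + (J 2 d - \<rho> 2 * d)\<bar> \<le> 3 * (\<kappa> * (t * M))"
    by (intro abs3 approx(2) small[OF \<eta>(1)]) simp_all
  moreover have "\<rho> 0 * a \<eta> + \<rho> 1 * b \<eta> + \<rho> 2 * d = t * (s * K) + (\<rho> 0 - \<rho> 1) * \<eta>"
    by (simp add: a_def b_def d_def K_def algebra_simps)
  moreover have "(\<rho> 0 - \<rho> 1) * \<eta> \<le> t * (\<bar>K\<bar> / 4)"
  proof -
    have "(\<rho> 0 - \<rho> 1) * \<eta> \<le> \<bar>\<rho> 0 - \<rho> 1\<bar> * \<bar>\<eta>\<bar>" by (metis abs_ge_self abs_mult)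
    also have "\<dots> \<le> \<bar>\<rho> 0 - \<rho> 1\<bar> * (\<beta> * t)" using \<eta>(1) by (rule mult_left_mono) simp
    also have "\<dots> \<le> t * (\<bar>K\<bar> / 4)" using mult_left_mono[OF \<beta>K', of t] t by (simp add: mult_ac)
    finally show ?thesis .
  qed
  moreover have "3 * (\<kappa> * (t * M)) \<le> t * (\<bar>K\<bar> / 2)"
    using mult_left_mono[OF \<kappa>(3), of t] t by (simp add: mult_ac)
  moreover have "t * (s * K) + t * (\<bar>K\<bar> / 4) + t * (\<bar>K\<bar> / 2) < 0"
    using K t unfolding s(2) by (simp add: field_simps)
  ultimately show False by linarith
qed

context control_system begin

text \<open>Changes of duration with sum 0 restore the horizon \<open>T\<close>, and the distance
  condition restores \<open>L\<close>, so the result is admissible. The number of starts has not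
  grown, hence optimality forces the sum of the \<open>J\<close> terms to be nonnegative.\<close>

lemma adjustable_three_collinear:
  assumes opt: "solves_problem_P f h \<alpha> T L x0 u x" and \<alpha>: "\<alpha> > 0"
    and ord: "0 \<le> a0" "b0 \<le> a1" "b1 \<le> a2" "b2 \<le> T"
    and adj: "adjustable u x a0 b0 c0 \<rho>0" "adjustable u x a1 b1 c1 \<rho>1" "adjustable u x a2 b2 c2 \<rho>2"
    and distinct: "c0 \<noteq> c1"
  shows "\<rho>0 * (c1 - c2) + \<rho>1 * (c2 - c0) + \<rho>2 * (c0 - c1) = 0"
proof -
  have tr: "trajectory T u x" and x0: "x 0 = x0" and L: "integral {0..T} x = L"
    using opt unfolding solves_problem_P_def admissible_iff_trajectory by auto
  define c \<rho> where "c = (\<lambda>i::nat. if i = 0 then c0 else if i = 1 then c1 else c2)"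
    and "\<rho> = (\<lambda>i::nat. if i = 0 then \<rho>0 else if i = 1 then \<rho>1 else \<rho>2)"
  define a b where "a = (\<lambda>i::nat. if i = 0 then a0 else if i = 1 then a1 else a2)"
    and "b = (\<lambda>i::nat. if i = 0 then b0 else if i = 1 then b1 else b2)"
  have "adjustable u x (a i) (b i) (c i) (\<rho> i)" for i
    using adj by (simp add: a_def b_def c_def \<rho>_def)
  then obtain \<omega> D J where \<omega>: "\<And>i. \<omega> i > 0" and zero: "\<And>i. D i 0 = 0" "\<And>i. J i 0 = 0"
    and cont: "\<And>i. continuous_on {-\<omega> i<..<\<omega> i} (D i)"
    and der: "\<And>i. (D i has_real_derivative c i) (at 0)" "\<And>i. (J i has_real_derivative \<rho> i) (at 0)"
    and window: "\<And>i. replaceable_window u x (a i) (b i) (\<omega> i) (D i) (J i)"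
    unfolding adjustable_def by metis
  have surgery: "\<exists>v y. trajectory (T + w) v y \<and> a i \<le> T + w \<and> (\<forall>t\<in>{0..a i}. v t = u t \<and> y t = x t) \<and>
           integral {0..T + w} y = integral {0..T} x' + D i w \<and>
           integral {0..T + w} (\<lambda>t. h (y t) (v t)) = integral {0..T} (\<lambda>t. h (x' t) (u' t)) + J i w \<and>
           switch_ons (T + w) v \<le> switch_ons T u'"
    if "\<bar>w\<bar> < \<omega> i" "trajectory T u' x'" "b i \<le> T" "\<And>t. t \<in> {0..b i} \<Longrightarrow> u' t = u t \<and> x' t = x t" for i w T u' x'
    using window[of i] that unfolding replaceable_window_def by blast
  define w0 where "w0 = min (\<omega> 0) (min (\<omega> 1) (\<omega> 2))"
  have w0: "w0 > 0" "w0 \<le> \<omega> 0" "w0 \<le> \<omega> 1" "w0 \<le> \<omega> 2"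
    using \<omega> by (auto simp: w0_def)
  have ab: "b 0 \<le> a 1" "b 1 \<le> a 2" "b 2 \<le> T" "0 \<le> a 0"
    using ord by (simp_all add: a_def b_def)
  have "\<rho> 0 * (c 1 - c 2) + \<rho> 1 * (c 2 - c 0) + \<rho> 2 * (c 0 - c 1) = 0"
  proof (rule lagrange_three[OF w0(1)])
    show "continuous_on {-w0<..<w0} (D i)" if "i < 3" for i
    proof -
      from that consider "i = 0" | "i = 1" | "i = 2" by linarith
      then have "w0 \<le> \<omega> i" by cases (use w0 in simp_all)
      then show ?thesis by (intro continuous_on_subset[OF cont]) auto
    qed
    show "c 0 \<noteq> c 1" using distinct by (simp add: c_def)
    fix \<delta>0 \<delta>1 \<delta>2
    assume \<delta>: "\<bar>\<delta>0\<bar> < w0" "\<bar>\<delta>1\<bar> < w0" "\<bar>\<delta>2\<bar> < w0" and sum: "\<delta>0 + \<delta>1 + \<delta>2 = 0"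
      and dist: "D 0 \<delta>0 + D 1 \<delta>1 + D 2 \<delta>2 = 0"
    obtain u2 x2 where s2: "trajectory (T + \<delta>2) u2 x2" "a 2 \<le> T + \<delta>2"
      "\<And>t. t \<in> {0..a 2} \<Longrightarrow> u2 t = u t \<and> x2 t = x t"
      "integral {0..T + \<delta>2} x2 = integral {0..T} x + D 2 \<delta>2"
      "integral {0..T + \<delta>2} (\<lambda>t. h (x2 t) (u2 t)) = integral {0..T} (\<lambda>t. h (x t) (u t)) + J 2 \<delta>2"
      "switch_ons (T + \<delta>2) u2 \<le> switch_ons T u"
      using surgery[of \<delta>2 2 T u x] \<delta>(3) w0(4) tr ab(3) by auto
    have "\<exists>v y. trajectory (T + \<delta>2 + \<delta>1) v y \<and> a 1 \<le> T + \<delta>2 + \<delta>1 \<and> (\<forall>t\<in>{0..a 1}. v t = u t \<and> y t = x t) \<and>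
           integral {0..T + \<delta>2 + \<delta>1} y = integral {0..T + \<delta>2} x2 + D 1 \<delta>1 \<and>
           integral {0..T + \<delta>2 + \<delta>1} (\<lambda>t. h (y t) (v t)) = integral {0..T + \<delta>2} (\<lambda>t. h (x2 t) (u2 t)) + J 1 \<delta>1 \<and>
           switch_ons (T + \<delta>2 + \<delta>1) v \<le> switch_ons (T + \<delta>2) u2"
      by (rule surgery) (use \<delta>(2) w0(3) s2(1-3) ab(2) in auto)
    then obtain u1 x1 where s1: "trajectory (T + \<delta>2 + \<delta>1) u1 x1" "a 1 \<le> T + \<delta>2 + \<delta>1"
      "\<And>t. t \<in> {0..a 1} \<Longrightarrow> u1 t = u t \<and> x1 t = x t"
      "integral {0..T + \<delta>2 + \<delta>1} x1 = integral {0..T + \<delta>2} x2 + D 1 \<delta>1"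
      "integral {0..T + \<delta>2 + \<delta>1} (\<lambda>t. h (x1 t) (u1 t)) = integral {0..T + \<delta>2} (\<lambda>t. h (x2 t) (u2 t)) + J 1 \<delta>1"
      "switch_ons (T + \<delta>2 + \<delta>1) u1 \<le> switch_ons (T + \<delta>2) u2"
      by blast
    have "\<exists>v y. trajectory (T + \<delta>2 + \<delta>1 + \<delta>0) v y \<and> a 0 \<le> T + \<delta>2 + \<delta>1 + \<delta>0 \<and> (\<forall>t\<in>{0..a 0}. v t = u t \<and> y t = x t) \<and>
           integral {0..T + \<delta>2 + \<delta>1 + \<delta>0} y = integral {0..T + \<delta>2 + \<delta>1} x1 + D 0 \<delta>0 \<and>
           integral {0..T + \<delta>2 + \<delta>1 + \<delta>0} (\<lambda>t. h (y t) (v t)) = integral {0..T + \<delta>2 + \<delta>1} (\<lambda>t. h (x1 t) (u1 t)) + J 0 \<delta>0 \<and>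
           switch_ons (T + \<delta>2 + \<delta>1 + \<delta>0) v \<le> switch_ons (T + \<delta>2 + \<delta>1) u1"
      by (rule surgery) (use \<delta>(1) w0(2) s1(1-3) ab(1) in auto)
    then obtain v y where s0: "trajectory (T + \<delta>2 + \<delta>1 + \<delta>0) v y"
      "\<And>t. t \<in> {0..a 0} \<Longrightarrow> v t = u t \<and> y t = x t"
      "integral {0..T + \<delta>2 + \<delta>1 + \<delta>0} y = integral {0..T + \<delta>2 + \<delta>1} x1 + D 0 \<delta>0"
      "integral {0..T + \<delta>2 + \<delta>1 + \<delta>0} (\<lambda>t. h (y t) (v t)) = integral {0..T + \<delta>2 + \<delta>1} (\<lambda>t. h (x1 t) (u1 t)) + J 0 \<delta>0"
      "switch_ons (T + \<delta>2 + \<delta>1 + \<delta>0) v \<le> switch_ons (T + \<delta>2 + \<delta>1) u1"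
      by blast
    have T: "T + \<delta>2 + \<delta>1 + \<delta>0 = T" using sum by simp
    have "admissible f T L x0 v y"
      unfolding admissible_iff_trajectory
      using s0(1,3) s0(2)[of 0] ab(4) x0 L s1(4) s2(4) dist unfolding T by auto
    then have "cost h \<alpha> T u x \<le> cost h \<alpha> T v y"
      using opt unfolding solves_problem_P_def by blast
    moreover have "\<alpha> * real (switch_ons T v) \<le> \<alpha> * real (switch_ons T u)"
      using s0(5) s1(6) s2(6) \<alpha> unfolding T by simp
    ultimately show "0 \<le> J 0 \<delta>0 + J 1 \<delta>1 + J 2 \<delta>2"
      using s0(4) s1(5) s2(5) unfolding T cost_def by linarith
  qed (use zero der in auto)
  then show ?thesis by (simp add: c_def \<rho>_def)
qed

end

section \<open>Strict convexity against collinearity\<close>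

text \<open>Up to sign the expression is the determinant with rows (1, p, F p), (1, q, F q), (1, r,
  F r). It is the convexity inequality at \<open>q\<close> multiplied by
  \<open>r - p\<close>.\<close>

lemma strictly_convex_not_collinear:
  assumes F: "strictly_convex_on UNIV F" and less: "p < q" "q < r"
  shows "F p * (q - r) + F q * (r - p) + F r * (p - q) < 0"
proof -
  define \<theta> where "\<theta> = (q - p) / (r - p)"
  have \<theta>: "0 < \<theta>" "\<theta> < 1" "\<theta> * (r - p) = q - p" using less by (auto simp: \<theta>_def)
  have "(1 - \<theta>) * p + \<theta> * r = q" using \<theta>(3) by (simp add: algebra_simps)
  then have "F q < (1 - \<theta>) * F p + \<theta> * F r"
    using F \<theta>(1,2) less unfolding strictly_convex_on_def by (metis UNIV_I less_trans less_irrefl)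
  then have "(r - p) * F q < (r - p) * ((1 - \<theta>) * F p + \<theta> * F r)"
    using less by simp
  also have "\<dots> = (r - p) * F p - (\<theta> * (r - p)) * F p + (\<theta> * (r - p)) * F r"
    by (simp add: algebra_simps)
  finally show ?thesis unfolding \<theta>(3) by (simp add: algebra_simps)
qed

text \<open>The determinant is alternating, so sorting the three points changes at most its
  sign.\<close>

lemma strictly_convex_not_collinear':
  assumes F: "strictly_convex_on UNIV F" and ne: "p \<noteq> q" "q \<noteq> r" "p \<noteq> r"
  shows "F p * (q - r) + F q * (r - p) + F r * (p - q) \<noteq> 0"
proof -
  consider "p < q \<and> q < r" | "p < r \<and> r < q" | "q < p \<and> p < r" | "q < r \<and> r < p" | "r < p \<and> p < q" | "r < q \<and> q < p"
    using ne by linarith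
  then show ?thesis
  proof cases
    case 1 then show ?thesis using strictly_convex_not_collinear[OF F, of p q r] by (simp add: algebra_simps)
  next
    case 2 then show ?thesis using strictly_convex_not_collinear[OF F, of p r q] by (simp add: algebra_simps)
  next
    case 3 then show ?thesis using strictly_convex_not_collinear[OF F, of q p r] by (simp add: algebra_simps)
  next
    case 4 then show ?thesis using strictly_convex_not_collinear[OF F, of q r p] by (simp add: algebra_simps)
  next
    case 5 then show ?thesis using strictly_convex_not_collinear[OF F, of r p q] by (simp add: algebra_simps)
  next
    case 6 then show ?thesis using strictly_convex_not_collinear[OF F, of r q p] by (simp add: algebra_simps)
  qed
qed

lemma card_le_2I:
  assumes "\<And>a b c. a \<in> A \<Longrightarrow> b \<in> A \<Longrightarrow> c \<in> A \<Longrightarrow> a \<noteq> b \<Longrightarrow> b \<noteq> c \<Longrightarrow> a \<noteq> c \<Longrightarrow> False"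
  shows "finite A \<and> card A \<le> 2"
proof -
  have "\<exists>a b. A \<subseteq> {a, b}"
  proof (rule ccontr)
    assume no: "\<nexists>a b. A \<subseteq> {a, b}"
    then obtain a where a: "a \<in> A" by blast
    with no obtain b where b: "b \<in> A" "a \<noteq> b" by blast
    with no obtain c where "c \<in> A" "c \<noteq> a" "c \<noteq> b" by blast
    with a b assms[of a b c] show False by blast
  qed
  then obtain a b where "A \<subseteq> {a, b}" by blast
  then have "finite A" "card A \<le> card {a, b}" by (auto intro: finite_subset card_mono)
  moreover have "card {a, b} \<le> 2" by (simp add: card_insert_if)
  ultimately show ?thesis by linarith
qed

context attracted_control_system begin

lemma extremal_marginal_costs_collinear:
  assumes opt: "solves_problem_P f h \<alpha> T L x0 u x" and \<alpha>: "\<alpha> > 0"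
    and ext: "weak_local_extremum_on {0<..<T} x t0" "weak_local_extremum_on {0<..<T} x t1"
      "weak_local_extremum_on {0<..<T} x t2"
    and less: "t0 < t1" "t1 < t2" and ne: "x t0 \<noteq> x t1"
  shows "marginal_cost (x t0) * (x t1 - x t2) + marginal_cost (x t1) * (x t2 - x t0)
    + marginal_cost (x t2) * (x t0 - x t1) = 0"
proof -
  have tr: "trajectory T u x"
    using opt unfolding solves_problem_P_def admissible_iff_trajectory by auto
  \<comment> \<open>Half of the smaller gap keeps the three windows from overlapping.\<close>
  define r where "r = min (t1 - t0) (t2 - t1) / 2"
  have r: "r > 0" "t0 + r \<le> t1 - r" "t1 + r \<le> t2 - r"
    using less by (auto simp: r_def min_def field_simps)
  obtain a0 b0 a1 b1 a2 b2 where
    "0 \<le> a0" "b0 < t0 + r" "adjustable u x a0 b0 (x t0) (marginal_cost (x t0))"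
    "t1 - r < a1" "b1 < t1 + r" "adjustable u x a1 b1 (x t1) (marginal_cost (x t1))"
    "t2 - r < a2" "b2 \<le> T" "adjustable u x a2 b2 (x t2) (marginal_cost (x t2))"
    using weak_local_extremum_adjustable[OF tr ext(1) r(1)] weak_local_extremum_adjustable[OF tr ext(2) r(1)]
      weak_local_extremum_adjustable[OF tr ext(3) r(1)] by blast
  then show ?thesis
    using r(2,3) ne by (intro adjustable_three_collinear[OF opt \<alpha>]) auto
qed

end

section \<open>At most two extremal values\<close>

theorem proposition1:
  fixes f h :: "real \<Rightarrow> bool \<Rightarrow> real"
    and \<alpha> V_up V_low T L x0 :: real
  assumes h_nonneg: "\<And>x c. 0 \<le> h x c"
    and h_C1: "\<And>c. (\<lambda>x. h x c) C1_differentiable_on UNIV"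
    and alpha_pos: "\<alpha> > 0"
    and A1: "\<And>c. continuous_on UNIV (\<lambda>x. f x c)"
    and A2: "\<And>c \<xi>. unique_forward_solution f c \<xi>"
    and B1: "V_up > 0" "\<And>x. x < V_up \<Longrightarrow> f x True > 0" "f V_up True = 0"
            "\<And>x. x > V_up \<Longrightarrow> f x True < 0"
    and B2: "\<And>x. f x False < f x True"
    and B3: "\<And>x. x > V_low \<Longrightarrow> f x False < 0" "\<And>x. x < V_low \<Longrightarrow> f x False > 0"
            "f V_low False = 0"
    and B4: "\<And>x. h x True > h x False" "\<And>x. h x False = 0"
    and B5: "mono (\<lambda>x. h x True)"
    and B6_convergence:
      "interval_lebesgue_integrable lborel (ereal V_low) (ereal V_up)
         (\<lambda>s. (h V_up True - h s True) / f s True)"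
      "interval_lebesgue_integrable lborel (ereal V_up) (ereal V_low)
         (\<lambda>s. (s - V_low) / f s False)"
      "interval_lebesgue_integrable lborel (ereal V_low) (ereal V_up)
         (\<lambda>s. (s - V_up) / f s True)"
    and B6:
      "(LBINT s=ereal V_low..ereal V_up. (h V_up True - h s True) / f s True) + \<alpha>
         < h V_up True / (V_up - V_low) *
             ((LBINT s=ereal V_up..ereal V_low. (s - V_low) / f s False) +
              (LBINT s=ereal V_low..ereal V_up. (s - V_up) / f s True))"
    and B7: "strictly_concave_on UNIV (\<lambda>x. h x True * f x False / (f x True - f x False)) \<or>
             strictly_convex_on UNIV (\<lambda>x. h x True * f x False / (f x True - f x False))"
    and T_pos: "T > 0"
    and L_pos: "L > 0"
    and x0_nonneg: "x0 \<ge> 0"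
  shows "(\<nexists>u x. solves_problem_P f h \<alpha> T L x0 u x) \<or>
         (\<forall>u x. solves_problem_P f h \<alpha> T L x0 u x \<longrightarrow>
            finite (x ` {t. weak_local_extremum_on {0<..<T} x t}) \<and>
            card (x ` {t. weak_local_extremum_on {0<..<T} x t}) \<le> 2)"
proof (intro disjI2 allI impI)
  fix u x assume opt: "solves_problem_P f h \<alpha> T L x0 u x"
  interpret attracted_control_system f h "\<lambda>k. if k then V_up else V_low"
  proof
    show "continuous_on UNIV (\<lambda>x. h x k)" for k
      using h_C1 by (rule C1_differentiable_imp_continuous_on)
    show "(x - (if k then V_up else V_low)) * f x k < 0" if "x \<noteq> (if k then V_up else V_low)" for x k
      using that B1(2,4)[of x] B3(1,2)[of x]
      by (cases k) (auto simp: mult_less_0_iff neq_iff)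
  qed (use A1 B1(3) B2 B3(3) in auto)
  define F where "F x = h x True * f x False / (f x True - f x False)" for x
  have mc: "marginal_cost c = - F c" for c by (simp add: marginal_cost_def F_def B4(2))
  have not_collinear: "F p * (q - r) + F q * (r - p) + F r * (p - q) \<noteq> 0"
    if "p \<noteq> q" "q \<noteq> r" "p \<noteq> r" for p q r
    using B7
  proof
    assume "strictly_convex_on UNIV (\<lambda>x. h x True * f x False / (f x True - f x False))"
    then show ?thesis
      using strictly_convex_not_collinear' that unfolding F_def by blast
  next
    assume "strictly_concave_on UNIV (\<lambda>x. h x True * f x False / (f x True - f x False))"
    then have "strictly_convex_on UNIV (\<lambda>x. - F x)"
      unfolding strictly_concave_on_def F_def .
    from strictly_convex_not_collinear'[OF this that] show ?thesis by (simp add: algebra_simps)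
  qed
  \<comment> \<open>The perturbation argument needs the extrema ordered in time, while the order of
    their values is arbitrary; this is why \<open>not_collinear\<close> assumes no order.\<close>
  have ordered: False
    if "weak_local_extremum_on {0<..<T} x t0" "weak_local_extremum_on {0<..<T} x t1"
      "weak_local_extremum_on {0<..<T} x t2" "t0 < t1" "t1 < t2"
      "x t0 \<noteq> x t1" "x t1 \<noteq> x t2" "x t0 \<noteq> x t2" for t0 t1 t2
    using extremal_marginal_costs_collinear[OF opt alpha_pos that(1-6)] not_collinear[OF that(6-8)]
    by (simp add: mc algebra_simps)
  show "finite (x ` {t. weak_local_extremum_on {0<..<T} x t}) \<and>
      card (x ` {t. weak_local_extremum_on {0<..<T} x t}) \<le> 2"
  proof (rule card_le_2I)
    fix a b c
    assume "a \<in> x ` {t. weak_local_extremum_on {0<..<T} x t}" "b \<in> x ` {t. weak_local_extremum_on {0<..<T} x t}"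
      "c \<in> x ` {t. weak_local_extremum_on {0<..<T} x t}" and ne: "a \<noteq> b" "b \<noteq> c" "a \<noteq> c"
    then obtain r s t where ext: "weak_local_extremum_on {0<..<T} x r" "weak_local_extremum_on {0<..<T} x s"
      "weak_local_extremum_on {0<..<T} x t" and abc: "a = x r" "b = x s" "c = x t"
      by blast
    have "r \<noteq> s" "s \<noteq> t" "r \<noteq> t" using ne abc by auto
    then consider "r < s \<and> s < t" | "r < t \<and> t < s" | "s < r \<and> r < t" | "s < t \<and> t < r" | "t < r \<and> r < s" | "t < s \<and> s < r"
      by linarith
    then show False
      by cases (use ext ne[unfolded abc] ordered[of r s t] ordered[of r t s] ordered[of s r t]
        ordered[of s t r] ordered[of t r s] ordered[of t s r] in simp_all)
  qed
qed

end
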